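(* Let $X$ be a Banach space. If $X$ is uniformly nonsquare, then $X$ has the fixed point property (FPP).
   Context: A Banach space $X$ with closed unit ball $B_X = \{x \in X : \|x\| \leq 1\}$ is uniformly nonsquare if there exists $\delta \in (0,1)$ such that for all $x, y \in B_X$, $$\min\left( \left\|\tfrac{1}{2}(x+y)\right\|, \left\|\tfrac{1}{2}(x-y)\right\| \right) \leq 1 - \delta.$$ A Banach space $X$ has the fixed point property (FPP) if for every nonempty closed bounded convex subset $C \subseteq X$, every nonexpansive map $T : C \to C$ (that is, $\|Tx - Ty\| \leq \|x - y\|$ for all $x, y \in C$) has a fixed point in $C$. *)

theory Defs
  imports "HOL-Analysis.Analysis"
begin

text \<open>Banach spaces are the types of class \<^class>\<open>banach\<close>; properties of a space are
  predicates on the type, passed as a value of type \<^typ>\<open>'a itself\<close>. Scalars are real: a complex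
  Banach space is covered through its underlying real Banach space, since neither property below
  involves the other scalars.\<close>

definition uniformly_nonsquare :: "'a::real_normed_vector itself \<Rightarrow> bool" where
  "uniformly_nonsquare X \<longleftrightarrow>
     (\<exists>\<delta>::real. 0 < \<delta> \<and> \<delta> < 1 \<and>
        (\<forall>x\<in>cball (0::'a) 1. \<forall>y\<in>cball (0::'a) 1.
           min (norm ((1/2) *\<^sub>R (x + y))) (norm ((1/2) *\<^sub>R (x - y))) \<le> 1 - \<delta>))"

definition nonexpansive_on :: "'a::real_normed_vector set \<Rightarrow> ('a \<Rightarrow> 'a) \<Rightarrow> bool" where
  "nonexpansive_on C T \<longleftrightarrow> (\<forall>x\<in>C. \<forall>y\<in>C. norm (T x - T y) \<le> norm (x - y))"

definition fixed_point_property :: "'a::real_normed_vector itself \<Rightarrow> bool" where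
  "fixed_point_property X \<longleftrightarrow>
     (\<forall>C::'a set. C \<noteq> {} \<longrightarrow> closed C \<longrightarrow> bounded C \<longrightarrow> convex C \<longrightarrow>
        (\<forall>T. T \<in> C \<rightarrow> C \<longrightarrow> nonexpansive_on C T \<longrightarrow> (\<exists>x\<in>C. T x = x)))"

end

theory Submission
  imports Defs
begin

text \<open>The proof has two halves: uniformly nonsquare spaces are reflexive (James), and a reflexive
  uniformly nonsquare space has the fixed point property (Garcia-Falset, Llorens-Fuster,
  Mazcunan-Navarro). Both are carried out without dual spaces or ultrapowers. Reflexivity enters
  only as the compactness property that directed families of bounded closed convex sets have a
  common point (\<open>nonsquare_closed_convex_compactness\<close>), and the weak limit of a sequence
  along an ultrafilter is replaced by a common point of the closed convex hulls of its restrictions to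
  the members of the ultrafilter.

  Compactness. Enlarge the directed family to a maximal filter \<open>F\<close> generated by closed convex sets.
  Every convex Lipschitz function converges along \<open>F\<close>, so \<open>F\<close> behaves like a point \<open>c\<close> of the bidual,
  and the iterated limit \<open>N(a\<^sub>1,\<dots>,a\<^sub>k) = lim\<^bsub>c\<^sub>1\<^esub> \<dots> lim\<^bsub>c\<^sub>k\<^esub> \<parallel>a\<^sub>1 c\<^sub>1 + \<dots> + a\<^sub>k c\<^sub>k\<parallel>\<close> is a seminorm
  on finite sequences. Because \<open>F\<close> consists of convex sets, neighbouring coefficients of equal sign may be
  added (\<open>iter_norm_merge\<close>). Nonsquareness passes to \<open>N\<close> and is used twice. Interlacing copies of
  \<open>(1,-1,1,-1,\<dots>)\<close> shows that the norms of these sequences grow sublinearly, whence a block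
  \<open>(t,-t)\<close> may be deleted without increasing \<open>N\<close> (\<open>iter_norm_delete_diff\<close>). Interlacing copies of
  \<open>(1,-2,2,-2,\<dots>)\<close> then shows that \<open>p\<^sub>n = N(1,-2,2,\<dots>,\<plusminus>2,\<mp>1)\<close> grows exponentially unless \<open>p\<^sub>0 = N(1,-1)\<close>
  is zero; since \<open>p\<^sub>n\<close> grows at most linearly, \<open>N(1,-1) = 0\<close>. This says that \<open>F\<close> is a Cauchy
  filter, and its limit lies in all the given sets.

  Fixed points. By compactness there is a minimal nonempty closed convex invariant set \<open>K\<close>; suppose its
  diameter \<open>d\<close> is positive. Choose points \<open>x\<^sub>n\<close> in \<open>K\<close> with \<open>\<parallel>T x\<^sub>n - x\<^sub>n\<parallel> \<longrightarrow> 0\<close>, with weak limit \<open>p\<close>, and let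
  \<open>w\<^sub>n\<close> solve \<open>w = (1-s) T w + s (x\<^sub>n + p)/2\<close> for a small fixed \<open>s\<close>. Then \<open>\<parallel>w\<^sub>n - w\<^sub>m\<parallel> \<le> d/2\<close>,
  the limit superior of \<open>\<parallel>w\<^sub>n - x\<^sub>n\<parallel>\<close> is at most \<open>d/2\<close>, and by the Goebel-Karlovitz lemma
  \<open>\<parallel>w\<^sub>n - p\<parallel>\<close> is almost \<open>d\<close>. If \<open>q\<close> is the weak limit of \<open>w\<^sub>n\<close>, then \<open>a = q - p\<close> and \<open>b = w\<^sub>n - w\<^sub>m\<close> have norm
  at most \<open>d/2\<close>, and for each pair \<open>(n,m)\<close> one of \<open>\<parallel>a \<plusminus> b\<parallel>\<close> is at most \<open>(1-\<delta>) d\<close>. Averaging over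
  \<open>m\<close> turns \<open>a + b\<close> into \<open>w\<^sub>n - p\<close>, and averaging over \<open>n\<close> turns \<open>a - b\<close> into \<open>w\<^sub>m - p\<close>; along an
  ultrafilter one of the two averages can be performed, which contradicts \<open>\<parallel>w\<^sub>n - p\<parallel> \<approx> d\<close>.\<close>

section \<open>Maximal filter bases\<close>

definition filter_base :: "'a set set \<Rightarrow> bool" where
  "filter_base \<A> \<longleftrightarrow> \<A> \<noteq> {} \<and> {} \<notin> \<A> \<and> (\<forall>A\<in>\<A>. \<forall>B\<in>\<A>. \<exists>D\<in>\<A>. D \<subseteq> A \<inter> B)"

text \<open>A common source of maximal objects: with \<open>\<S>\<close> the closed convex sets it yields the virtual limit
  points used for compactness, with \<open>\<S>\<close> the closed convex invariant sets it yields minimal invariant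
  sets, and with \<open>\<S>\<close> all sets it yields ultrafilters.\<close>

lemma maximal_filter_base:
  assumes base: "filter_base \<A>" and sub: "\<A> \<subseteq> \<S>"
    and Int: "\<And>A B. A \<in> \<S> \<Longrightarrow> B \<in> \<S> \<Longrightarrow> A \<inter> B \<in> \<S>"
  obtains M where "filter_base M" "\<A> \<subseteq> M" "M \<subseteq> \<S>"
    "\<And>D. D \<in> \<S> \<Longrightarrow> (\<And>A. A \<in> M \<Longrightarrow> A \<inter> D \<noteq> {}) \<Longrightarrow> D \<in> M"
proof -
  define Z where "Z = {M. filter_base M \<and> \<A> \<subseteq> M \<and> M \<subseteq> \<S>}"
  have "\<exists>U\<in>Z. \<forall>X\<in>c. X \<subseteq> U" if c: "subset.chain Z c" for c
  proof (cases "c = {}")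
    case True
    then show ?thesis using base sub by (auto simp: Z_def)
  next
    case False
    have cZ: "\<And>X. X \<in> c \<Longrightarrow> X \<in> Z" using c by (auto simp: subset.chain_def)
    have "\<exists>D\<in>\<Union>c. D \<subseteq> A \<inter> B" if "A \<in> \<Union>c" "B \<in> \<Union>c" for A B
    proof -
      from that obtain X Y where XY: "X \<in> c" "A \<in> X" "Y \<in> c" "B \<in> Y" by auto
      then have "X \<subseteq> Y \<or> Y \<subseteq> X" using c by (auto simp: subset.chain_def)
      then obtain W where W: "W \<in> c" "A \<in> W" "B \<in> W" using XY by auto
      then have "filter_base W" using cZ by (auto simp: Z_def)
      then show ?thesis using W unfolding filter_base_def by blast
    qed
    moreover have "{} \<notin> \<Union>c" using cZ by (auto simp: Z_def filter_base_def)
    moreover have "\<Union>c \<noteq> {}" using False cZ by (fastforce simp: Z_def filter_base_def)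
    moreover have "\<A> \<subseteq> \<Union>c" using False cZ by (auto simp: Z_def)
    moreover have "\<Union>c \<subseteq> \<S>" using cZ by (auto simp: Z_def)
    ultimately have "\<Union>c \<in> Z" by (simp add: Z_def filter_base_def)
    then show ?thesis by blast
  qed
  from subset_Zorn[OF this] obtain M where "M \<in> Z" and max: "\<And>X. X \<in> Z \<Longrightarrow> M \<subseteq> X \<Longrightarrow> X = M"
    by auto
  then have M: "filter_base M" "\<A> \<subseteq> M" "M \<subseteq> \<S>" by (auto simp: Z_def)
  have "D \<in> M" if D: "D \<in> \<S>" "\<And>A. A \<in> M \<Longrightarrow> A \<inter> D \<noteq> {}" for D
  proof -
    \<comment> \<open>Adjoining \<open>D\<close> and its traces on \<open>M\<close> gives a larger filter base.\<close>
    let ?M = "M \<union> insert D ((\<lambda>A. A \<inter> D) ` M)"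
    have dir: "\<exists>E\<in>M. E \<subseteq> A \<inter> B" if "A \<in> M" "B \<in> M" for A B
      using M(1) that unfolding filter_base_def by blast
    have ne: "M \<noteq> {}" "{} \<notin> M" using M(1) by (auto simp: filter_base_def)
    have "\<exists>E\<in>?M. E \<subseteq> A \<inter> B" if "A \<in> ?M" "B \<in> ?M" for A B
    proof -
      have "\<exists>A'\<in>M. A' \<inter> D \<subseteq> A" "\<exists>B'\<in>M. B' \<inter> D \<subseteq> B" using that ne by auto
      then obtain A' B' where "A' \<in> M" "A' \<inter> D \<subseteq> A" "B' \<in> M" "B' \<inter> D \<subseteq> B" by blast
      moreover obtain E where E: "E \<in> M" "E \<subseteq> A' \<inter> B'"
        using dir[OF \<open>A' \<in> M\<close> \<open>B' \<in> M\<close>] by blast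
      ultimately have "E \<inter> D \<subseteq> A \<inter> B" by blast
      moreover have "E \<inter> D \<in> ?M" using E by blast
      ultimately show ?thesis by (rule bexI)
    qed
    moreover have "{} \<notin> ?M" using D(2) ne by auto
    ultimately have "filter_base ?M" unfolding filter_base_def by auto
    moreover have "?M \<subseteq> \<S>" using M(3) D(1) Int by auto
    ultimately have "?M \<in> Z" using M(2) by (auto simp: Z_def)
    from max[OF this] show "D \<in> M" by auto
  qed
  with M that show thesis by blast
qed

section \<open>Iterated limits of norms along a maximal convex filter\<close>

text \<open>The homogeneous form, with a radius \<open>r\<close>, passes to limits of norms without a normalisation that might divide by zero.\<close>

definition nonsquare_by :: "real \<Rightarrow> 'a::real_normed_vector itself \<Rightarrow> bool" where
  "nonsquare_by \<delta> X \<longleftrightarrow> 0 < \<delta> \<and> \<delta> < 1 \<and>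
     (\<forall>(x::'a) y r. norm x \<le> r \<longrightarrow> norm y \<le> r \<longrightarrow>
        norm (x + y) \<le> 2 * (1 - \<delta>) * r \<or> norm (x - y) \<le> 2 * (1 - \<delta>) * r)"

lemma uniformly_nonsquare_scaled:
  assumes "uniformly_nonsquare TYPE('a::real_normed_vector)"
  obtains \<delta> where "nonsquare_by \<delta> TYPE('a)"
proof -
  obtain \<delta> where \<delta>: "0 < \<delta>" "\<delta> < 1" and sq: "\<And>x y::'a. norm x \<le> 1 \<Longrightarrow> norm y \<le> 1 \<Longrightarrow>
      min (norm ((1/2) *\<^sub>R (x + y))) (norm ((1/2) *\<^sub>R (x - y))) \<le> 1 - \<delta>"
    using assms unfolding uniformly_nonsquare_def by (auto simp: Ball_def)
  have "norm (x + y) \<le> 2 * (1 - \<delta>) * r \<or> norm (x - y) \<le> 2 * (1 - \<delta>) * r"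
    if xy: "norm x \<le> r" "norm y \<le> r" for x y :: 'a and r
  proof (cases "r = 0")
    case True
    then show ?thesis using xy by simp
  next
    case False
    then have r: "r > 0" using xy norm_ge_zero[of x] by linarith
    have "norm (x /\<^sub>R r) \<le> 1" "norm (y /\<^sub>R r) \<le> 1" using xy r by (auto simp: field_simps)
    from sq[OF this] have "min (norm (x + y) / r / 2) (norm (x - y) / r / 2) \<le> 1 - \<delta>"
      using r by (simp flip: scaleR_add_right scaleR_diff_right) (simp add: field_simps)
    then show ?thesis using r by (auto simp: min_def field_simps split: if_splits)
  qed
  with \<delta> that show thesis unfolding nonsquare_by_def by blast
qed

text \<open>Such a filter plays the role of an ultrafilter for convex functions, and of a single point of
  the bidual: for convex Lipschitz functions, the limit is the value at that point.\<close>

locale convex_ultrafilter =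
  fixes F :: "'a::real_normed_vector filter"
  assumes nontrivial: "F \<noteq> bot"
    and convex_basis: "eventually P F \<Longrightarrow> \<exists>C. convex C \<and> eventually (\<lambda>c. c \<in> C) F \<and> (\<forall>c\<in>C. P c)"
    and convergent: "convex_on UNIV G \<Longrightarrow> L-lipschitz_on UNIV G \<Longrightarrow> \<exists>l. (G \<longlongrightarrow> l) F"
    and eventually_norm_le: "\<exists>B. eventually (\<lambda>c. norm c \<le> B) F"
begin

text \<open>\<open>iter_norm [a\<^sub>1, \<dots>, a\<^sub>k] x\<close> is the norm of \<open>x + a\<^sub>1 c\<^sub>1 + \<dots> + a\<^sub>k c\<^sub>k\<close> where each \<open>c\<^sub>i\<close> is an
  independent copy of the virtual point, taken infinitely far beyond \<open>c\<^bsub>i-1\<^esub>\<close>. The base vector \<open>x\<close> is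
  kept because the recursion moves every chosen \<open>c\<^sub>i\<close> into it.\<close>

primrec iter_norm :: "real list \<Rightarrow> 'a \<Rightarrow> real" where
  "iter_norm [] = norm"
| "iter_norm (a # as) = (\<lambda>x. Lim F (\<lambda>c. iter_norm as (x + a *\<^sub>R c)))"

lemma convex_shift:
  assumes "convex_on UNIV (G :: 'a \<Rightarrow> real)" shows "convex_on UNIV (\<lambda>c. G (x + a *\<^sub>R c))"
proof (rule convex_onI)
  fix t :: real and y z assume t: "0 < t" "t < 1"
  have "x + a *\<^sub>R ((1 - t) *\<^sub>R y + t *\<^sub>R z) = (1 - t) *\<^sub>R (x + a *\<^sub>R y) + t *\<^sub>R (x + a *\<^sub>R z)"
    by (simp add: algebra_simps)
  then show "G (x + a *\<^sub>R ((1 - t) *\<^sub>R y + t *\<^sub>R z)) \<le> (1 - t) * G (x + a *\<^sub>R y) + t * G (x + a *\<^sub>R z)"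
    using convex_onD[OF assms, of t "x + a *\<^sub>R y" "x + a *\<^sub>R z"] t by auto
qed auto

lemma lipschitz_shift:
  assumes "1-lipschitz_on UNIV (G :: 'a \<Rightarrow> real)" shows "\<bar>a\<bar>-lipschitz_on UNIV (\<lambda>c. G (x + a *\<^sub>R c))"
proof (rule lipschitz_onI)
  fix y z
  have "dist (x + a *\<^sub>R y) (x + a *\<^sub>R z) = \<bar>a\<bar> * dist y z"
    by (simp add: dist_norm flip: scaleR_diff_right)
  then show "dist (G (x + a *\<^sub>R y)) (G (x + a *\<^sub>R z)) \<le> \<bar>a\<bar> * dist y z"
    using lipschitz_onD[OF assms, of "x + a *\<^sub>R y" "x + a *\<^sub>R z"] by auto
qed auto

lemma tendsto_Lim_shift:
  assumes "convex_on UNIV G" "1-lipschitz_on UNIV G"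
  shows "((\<lambda>c. G (x + a *\<^sub>R c)) \<longlongrightarrow> Lim F (\<lambda>c. G (x + a *\<^sub>R c))) F"
  using convergent[OF convex_shift[OF assms(1)] lipschitz_shift[OF assms(2)]]
    tendsto_Lim[OF nontrivial] by metis

text \<open>Both properties survive a limit along \<open>F\<close>; they are what makes the next limit exist.\<close>

lemma iter_norm_convex_lipschitz: "convex_on UNIV (iter_norm as) \<and> 1-lipschitz_on UNIV (iter_norm as)"
proof (induction as)
  case Nil
  have "1-lipschitz_on UNIV (norm :: 'a \<Rightarrow> real)"
    by (rule lipschitz_onI) (auto simp: dist_norm norm_triangle_ineq3)
  moreover have "convex_on UNIV (norm :: 'a \<Rightarrow> real)"
    using convex_on_dist[of UNIV "0 :: 'a"] by simp
  ultimately show ?case by simp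
next
  case (Cons a as)
  define G where "G = iter_norm as"
  define H where "H x = Lim F (\<lambda>c. G (x + a *\<^sub>R c))" for x
  have lim: "((\<lambda>c. G (x + a *\<^sub>R c)) \<longlongrightarrow> H x) F" for x
    unfolding H_def using tendsto_Lim_shift Cons G_def by blast
  have "convex_on UNIV H"
  proof (rule convex_onI)
    fix t :: real and y z assume t: "0 < t" "t < 1"
    have "G ((1 - t) *\<^sub>R y + t *\<^sub>R z + a *\<^sub>R c) \<le> (1 - t) * G (y + a *\<^sub>R c) + t * G (z + a *\<^sub>R c)" for c
    proof -
      have "(1 - t) *\<^sub>R y + t *\<^sub>R z + a *\<^sub>R c = (1 - t) *\<^sub>R (y + a *\<^sub>R c) + t *\<^sub>R (z + a *\<^sub>R c)"
        by (simp add: algebra_simps)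
      then show ?thesis
        using convex_onD[of UNIV G t "y + a *\<^sub>R c" "z + a *\<^sub>R c"] Cons t by (auto simp: G_def)
    qed
    then show "H ((1 - t) *\<^sub>R y + t *\<^sub>R z) \<le> (1 - t) * H y + t * H z"
      using tendsto_le[OF nontrivial tendsto_add[OF tendsto_mult_left[OF lim] tendsto_mult_left[OF lim]] lim]
      by (simp add: always_eventually)
  qed auto
  moreover have "1-lipschitz_on UNIV H"
  proof (rule lipschitz_onI)
    fix y z
    have "\<bar>G (y + a *\<^sub>R c) - G (z + a *\<^sub>R c)\<bar> \<le> dist y z" for c
      using lipschitz_onD[of 1 UNIV G "y + a *\<^sub>R c" "z + a *\<^sub>R c"] Cons by (auto simp: G_def dist_real_def)
    then show "dist (H y) (H z) \<le> 1 * dist y z"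
      unfolding dist_real_def
      by (intro tendsto_upperbound[OF tendsto_rabs[OF tendsto_diff[OF lim lim]]]) (auto simp: nontrivial)
  qed auto
  moreover have "iter_norm (a # as) = H" by (simp add: H_def[abs_def] G_def)
  ultimately show ?case by metis
qed

lemmas iter_norm_convex = iter_norm_convex_lipschitz[THEN conjunct1]
lemmas iter_norm_lipschitz = iter_norm_convex_lipschitz[THEN conjunct2]

lemma iter_norm_tendsto:
  "((\<lambda>c. iter_norm as (x + a *\<^sub>R c)) \<longlongrightarrow> iter_norm (a # as) x) F"
  using tendsto_Lim_shift[OF iter_norm_convex iter_norm_lipschitz] by simp

text \<open>From here on the limit is handled through \<open>iter_norm_tendsto\<close> only.\<close>

declare iter_norm.simps(2) [simp del]

lemma iter_norm_eqI: "((\<lambda>c. iter_norm as (x + a *\<^sub>R c)) \<longlongrightarrow> l) F \<Longrightarrow> iter_norm (a # as) x = l"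
  using iter_norm_tendsto tendsto_unique[OF nontrivial] by blast

lemma iter_norm_mono:
  assumes "\<And>x. iter_norm as x \<le> iter_norm bs x" shows "iter_norm (pre @ as) x \<le> iter_norm (pre @ bs) x"
proof (induction pre arbitrary: x)
  case (Cons a pre)
  then show ?case
    by (auto intro!: tendsto_le[OF nontrivial iter_norm_tendsto iter_norm_tendsto])
qed (use assms in auto)

lemma iter_norm_cong:
  assumes "iter_norm as = iter_norm bs" shows "iter_norm (a # as) = iter_norm (a # bs)"
  using assms by (simp add: iter_norm.simps)

lemma iter_norm_zero [simp]: "iter_norm (0 # as) = iter_norm as"
  by (auto intro!: iter_norm_eqI)

lemma iter_norm_zeros: "iter_norm (replicate n 0 @ as) = iter_norm as"
  by (induction n) auto

lemma iter_norm_triangle: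
  "length as = length bs \<Longrightarrow> iter_norm (map2 (+) as bs) (x + y) \<le> iter_norm as x + iter_norm bs y"
proof (induction as bs arbitrary: x y rule: list_induct2)
  case Nil
  then show ?case by (simp add: norm_triangle_ineq)
next
  case (Cons a as b bs)
  have "iter_norm (map2 (+) as bs) (x + y + (a + b) *\<^sub>R c)
      \<le> iter_norm as (x + a *\<^sub>R c) + iter_norm bs (y + b *\<^sub>R c)" for c
    using Cons(2)[of "x + a *\<^sub>R c" "y + b *\<^sub>R c"] by (simp add: algebra_simps)
  then show ?case
    by (auto intro!: tendsto_le[OF nontrivial tendsto_add[OF iter_norm_tendsto iter_norm_tendsto] iter_norm_tendsto])
qed

lemma iter_norm_scale: "iter_norm (map ((*) r) as) (r *\<^sub>R x) = \<bar>r\<bar> * iter_norm as x"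
proof (induction as arbitrary: x)
  case (Cons a as)
  have "iter_norm (map ((*) r) as) (r *\<^sub>R x + (r * a) *\<^sub>R c) = \<bar>r\<bar> * iter_norm as (x + a *\<^sub>R c)" for c
    using Cons[of "x + a *\<^sub>R c"] by (simp add: scaleR_add_right)
  then show ?case
    using tendsto_mult_left[OF iter_norm_tendsto, of "\<bar>r\<bar>" as x a] by (auto intro!: iter_norm_eqI)
qed simp

lemma iter_norm_nonneg: "0 \<le> iter_norm as x"
proof (induction as arbitrary: x)
  case (Cons a as)
  then show ?case by (auto intro!: tendsto_lowerbound[OF iter_norm_tendsto] simp: nontrivial)
qed simp

text \<open>Let \<open>G\<close> be the norm after the first two steps. Convexity of \<open>G\<close> bounds its value at
  \<open>a c + b c'\<close> by the mean of the values at \<open>(a+b) c\<close> and \<open>(a+b) c'\<close>, which have the same limit \<open>r\<close>.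
  Conversely, for \<open>c, c'\<close> in one convex set of the filter on which \<open>G\<close> exceeds \<open>r - e\<close>,
  the point \<open>(a c + b c')/(a+b)\<close> is again in that set.\<close>

lemma iter_norm_merge:
  assumes "0 \<le> a * b" shows "iter_norm (a # b # as) = iter_norm ((a + b) # as)"
proof (cases "a + b = 0")
  case True
  then have "a = 0 \<and> b = 0" using assms by (smt (verit) mult_less_0_iff)
  then show ?thesis by simp
next
  case False
  show ?thesis
  proof
    fix x
    define G where "G = iter_norm as"
    define \<mu> where "\<mu> = b / (a + b)"
    have \<mu>: "0 \<le> \<mu>" "\<mu> \<le> 1"
      using assms False
      unfolding \<mu>_def by (auto simp: zero_le_mult_iff zero_le_divide_iff divide_le_eq_1)
    have ab: "a = (1 - \<mu>) * (a + b)" "b = \<mu> * (a + b)" using False by (auto simp: \<mu>_def field_simps)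
    define r where "r = iter_norm ((a + b) # as) x"
    define Q where "Q c = iter_norm (b # as) (x + a *\<^sub>R c)" for c
    have lim: "((\<lambda>c. G (x + (a + b) *\<^sub>R c)) \<longlongrightarrow> r) F"
      unfolding G_def r_def by (rule iter_norm_tendsto)
    have limQ: "((\<lambda>c'. G (x + a *\<^sub>R c + b *\<^sub>R c')) \<longlongrightarrow> Q c) F" for c
      unfolding G_def Q_def by (rule iter_norm_tendsto)
    have comb: "x + a *\<^sub>R c + b *\<^sub>R c' = x + (a + b) *\<^sub>R ((1 - \<mu>) *\<^sub>R c + \<mu> *\<^sub>R c')" for c c'
      using ab by (metis (no_types, lifting) add.assoc mult.commute scaleR_add_right scaleR_scaleR)
    have "Q c \<le> (1 - \<mu>) * G (x + (a + b) *\<^sub>R c) + \<mu> * r" for c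
    proof (rule tendsto_le[OF nontrivial _ limQ])
      show "((\<lambda>c'. (1 - \<mu>) * G (x + (a + b) *\<^sub>R c) + \<mu> * G (x + (a + b) *\<^sub>R c'))
          \<longlongrightarrow> (1 - \<mu>) * G (x + (a + b) *\<^sub>R c) + \<mu> * r) F"
        by (intro tendsto_intros lim)
      have "G (x + a *\<^sub>R c + b *\<^sub>R c') \<le> (1 - \<mu>) * G (x + (a + b) *\<^sub>R c) + \<mu> * G (x + (a + b) *\<^sub>R c')" for c'
        unfolding comb using convex_onD[OF convex_shift[OF iter_norm_convex], of \<mu> c c'] \<mu>
        by (auto simp: G_def)
      then show "\<forall>\<^sub>F c' in F. G (x + a *\<^sub>R c + b *\<^sub>R c')
          \<le> (1 - \<mu>) * G (x + (a + b) *\<^sub>R c) + \<mu> * G (x + (a + b) *\<^sub>R c')" by simp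
    qed
    moreover have "((\<lambda>c. (1 - \<mu>) * G (x + (a + b) *\<^sub>R c) + \<mu> * r) \<longlongrightarrow> (1 - \<mu>) * r + \<mu> * r) F"
      by (intro tendsto_intros lim)
    ultimately have "iter_norm (a # b # as) x \<le> (1 - \<mu>) * r + \<mu> * r"
      using tendsto_le[OF nontrivial _ iter_norm_tendsto[of "b # as"]] unfolding Q_def
      by (metis (no_types, lifting) always_eventually)
    then have le: "iter_norm (a # b # as) x \<le> r" by (simp add: algebra_simps)
    have ge: "r - e \<le> iter_norm (a # b # as) x" if "e > 0" for e
    proof -
      have "\<forall>\<^sub>F c in F. r - e < G (x + (a + b) *\<^sub>R c)" using order_tendstoD(1)[OF lim] that by simp
      then obtain C where C: "convex C" "\<forall>\<^sub>F c in F. c \<in> C"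
        and gt: "\<And>c. c \<in> C \<Longrightarrow> r - e < G (x + (a + b) *\<^sub>R c)" using convex_basis by blast
      have "r - e \<le> Q c" if "c \<in> C" for c
      proof (rule tendsto_lowerbound[OF limQ])
        have "(1 - \<mu>) *\<^sub>R c + \<mu> *\<^sub>R c' \<in> C" if "c' \<in> C" for c'
          using C(1) \<open>c \<in> C\<close> that \<mu> by (simp add: convex_alt)
        then show "\<forall>\<^sub>F c' in F. r - e \<le> G (x + a *\<^sub>R c + b *\<^sub>R c')"
          unfolding comb using C(2) gt by (auto elim!: eventually_mono intro: less_imp_le)
      qed (rule nontrivial)
      then show ?thesis
        using C(2) by (intro tendsto_lowerbound[OF iter_norm_tendsto])
          (auto elim!: eventually_mono simp: Q_def nontrivial)
    qed
    have "r \<le> iter_norm (a # b # as) x"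
    proof (rule field_le_epsilon)
      fix e :: real assume "0 < e"
      from ge[OF this] show "r \<le> iter_norm (a # b # as) x + e" by linarith
    qed
    with le show "iter_norm (a # b # as) x = iter_norm ((a + b) # as) x" by (simp add: r_def)
  qed
qed

end

text \<open>The list \<open>1 # zigzag 1 n\<close> is \<open>1, -2, 2, -2, \<dots>\<close>, closed by a \<open>\<plusminus>1\<close> that makes the total zero. Its
  partial sums are \<open>1, -1, 1, \<dots>\<close> (\<open>n + 1\<close> of them) and \<open>0\<close>; the argument \<open>e\<close> is the
  current partial sum.\<close>

primrec zigzag :: "real \<Rightarrow> nat \<Rightarrow> real list" where
  "zigzag e 0 = [- e]"
| "zigzag e (Suc n) = (- 2 * e) # zigzag (- e) n"

lemma zigzag_uminus: "zigzag (- e) n = map ((*) (- 1)) (zigzag e n)"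
proof (induction n arbitrary: e)
  case (Suc n)
  show ?case using Suc[of "- e"] by simp
qed simp

lemma sum_list_abs_zigzag: "\<bar>e\<bar> = 1 \<Longrightarrow> (\<Sum>a\<leftarrow>zigzag e n. \<bar>a\<bar>) = 2 * real n + 1"
  by (induction n arbitrary: e) (auto simp: abs_mult)

abbreviation diffs :: "real \<Rightarrow> nat \<Rightarrow> real list" where
  "diffs t m \<equiv> concat (replicate m [t, - t])"

text \<open>The difference of the two ways \<open>a\<^sub>1, 0, a\<^sub>2, 0, \<dots>\<close> and \<open>0, a\<^sub>1, 0, a\<^sub>2, \<dots>\<close> of spreading a list.\<close>

abbreviation split_diff :: "real list \<Rightarrow> real list" where
  "split_diff as \<equiv> concat (map (\<lambda>a. [a, - a]) as)"

context convex_ultrafilter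
begin

lemma iter_norm_append_cong:
  assumes "iter_norm as = iter_norm bs" shows "iter_norm (pre @ as) = iter_norm (pre @ bs)"
  by (induction pre) (auto intro: iter_norm_cong assms)

lemma iter_norm_append_zeros: "iter_norm (as @ replicate n 0) = iter_norm as"
  using iter_norm_append_cong[of "replicate n 0 @ []" "[]" as] iter_norm_zeros[of n "[]"] by simp

lemma iter_norm_bound:
  assumes "\<forall>\<^sub>F c in F. norm c \<le> B"
  shows "iter_norm as x \<le> norm x + B * (\<Sum>a\<leftarrow>as. \<bar>a\<bar>)"
proof (induction as arbitrary: x)
  case (Cons a as)
  have "iter_norm as (x + a *\<^sub>R c) \<le> norm x + B * (\<Sum>a\<leftarrow>a # as. \<bar>a\<bar>)" if "norm c \<le> B" for c
  proof -
    have "norm (x + a *\<^sub>R c) \<le> norm x + \<bar>a\<bar> * B"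
      using norm_triangle_ineq[of x "a *\<^sub>R c"] mult_left_mono[OF that, of "\<bar>a\<bar>"] by simp
    then show ?thesis using Cons[of "x + a *\<^sub>R c"] by (simp add: algebra_simps)
  qed
  then show ?case
    using assms by (intro tendsto_upperbound[OF iter_norm_tendsto _ nontrivial]) (auto elim: eventually_mono)
qed simp

text \<open>The inequality holds pointwise before the limits are taken, and all four iterated limits run
  along the same points \<open>c\<close>.\<close>

lemma iter_norm_nonsquare:
  assumes ns: "nonsquare_by \<delta> TYPE('a)" and "length as = length bs"
  shows "min (iter_norm (map2 (+) as bs) (x + y)) (iter_norm (map2 (-) as bs) (x - y))
     \<le> 2 * (1 - \<delta>) * max (iter_norm as x) (iter_norm bs y)"
  using assms(2)
proof (induction as bs arbitrary: x y rule: list_induct2)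
  case Nil
  have "norm (x + y) \<le> 2 * (1 - \<delta>) * max (norm x) (norm y) \<or> norm (x - y) \<le> 2 * (1 - \<delta>) * max (norm x) (norm y)"
    using ns unfolding nonsquare_by_def by simp
  then show ?case by (auto simp: min_le_iff_disj)
next
  case (Cons a as b bs)
  let ?L = "\<lambda>c. min (iter_norm (map2 (+) as bs) (x + y + (a + b) *\<^sub>R c))
                    (iter_norm (map2 (-) as bs) (x - y + (a - b) *\<^sub>R c))"
  let ?R = "\<lambda>c. 2 * (1 - \<delta>) * max (iter_norm as (x + a *\<^sub>R c)) (iter_norm bs (y + b *\<^sub>R c))"
  have le: "?L c \<le> ?R c" for c
    using Cons(2)[of "x + a *\<^sub>R c" "y + b *\<^sub>R c"] by (simp add: algebra_simps)
  have L: "(?L \<longlongrightarrow> min (iter_norm ((a + b) # map2 (+) as bs) (x + y)) (iter_norm ((a - b) # map2 (-) as bs) (x - y))) F"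
    by (intro tendsto_min iter_norm_tendsto)
  have R: "(?R \<longlongrightarrow> 2 * (1 - \<delta>) * max (iter_norm (a # as) x) (iter_norm (b # bs) y)) F"
    by (intro tendsto_intros tendsto_max iter_norm_tendsto)
  from tendsto_le[OF nontrivial R L always_eventually[OF allI[OF le]]] show ?case by simp
qed

section \<open>Deletion of adjacent differences\<close>

text \<open>The sequence \<open>(1,-1,1,-1)\<close> is the sum of \<open>(1,0,0,-1)\<close> and \<open>(0,-1,1,0)\<close>, whose difference
  \<open>(1,1,-1,-1)\<close> merges to \<open>(2,-2)\<close>. After repeating these blocks the difference has the maximal
  norm, so nonsquareness makes the sum small.\<close>

lemma iter_norm_diffs_double:
  assumes "nonsquare_by \<delta> TYPE('a)"
  shows "iter_norm (diffs 1 (2 * k)) 0 \<le> 2 * (1 - \<delta>) * iter_norm (diffs 1 k) 0"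
proof -
  define u :: "real list" where "u = concat (replicate k [1, 0, 0, - 1])"
  define v :: "real list" where "v = concat (replicate k [0, - 1, 1, 0])"
  define s where "s = iter_norm (diffs 1 k) 0"
  have \<delta>: "0 < \<delta>" "\<delta> < 1" using assms by (auto simp: nonsquare_by_def)
  have s0: "0 \<le> s" unfolding s_def by (rule iter_norm_nonneg)
  have "iter_norm u = iter_norm (diffs 1 k)"
    unfolding u_def by (induction k) (auto intro!: iter_norm_cong)
  then have Nu: "iter_norm u 0 = s" by (simp add: s_def)
  have "iter_norm v = iter_norm (diffs (- 1) k)"
    unfolding v_def by (induction k) (auto intro!: iter_norm_cong)
  moreover have "diffs (- 1) k = map ((*) (- 1)) (diffs 1 k)" by (induction k) auto
  ultimately have Nv: "iter_norm v 0 = s"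
    using iter_norm_scale[of "- 1" "diffs 1 k" 0] by (simp add: s_def)
  have len: "length u = length v" unfolding u_def v_def by (induction k) auto
  have plus: "map2 (+) u v = diffs 1 (2 * k)" unfolding u_def v_def by (induction k) auto
  have "map2 (-) u v = concat (replicate k [1, 1, - 1, - 1])" unfolding u_def v_def by (induction k) auto
  moreover have "iter_norm (concat (replicate k [1, 1, - 1, - 1])) = iter_norm (concat (replicate k [2, - 2]))"
    by (induction k) (auto simp: iter_norm_merge intro!: iter_norm_cong)
  moreover have "concat (replicate k [2, - 2]) = map ((*) 2) (diffs 1 k)" by (induction k) auto
  ultimately have minus: "iter_norm (map2 (-) u v) 0 = 2 * s"
    using iter_norm_scale[of 2 "diffs 1 k" 0] by (simp add: s_def)
  have "min (iter_norm (diffs 1 (2 * k)) 0) (2 * s) \<le> 2 * (1 - \<delta>) * s"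
    using iter_norm_nonsquare[OF assms len, of 0 0] by (simp add: plus minus Nu Nv)
  moreover have "iter_norm (diffs 1 (2 * k)) 0 \<le> 2 * s"
    using iter_norm_triangle[OF len, of 0 0] by (simp add: plus Nu Nv)
  ultimately show ?thesis
    by (simp add: s_def[symmetric] min_def split: if_splits)
qed

lemma iter_norm_diffs_sublinear:
  assumes ns: "nonsquare_by \<delta> TYPE('a)" and "e > 0"
  obtains m where "m > 0" "iter_norm (diffs 1 m) 0 \<le> e * real m"
proof -
  define s where "s = iter_norm (diffs 1 1) 0"
  have \<delta>: "0 < \<delta>" "\<delta> < 1" using ns by (auto simp: nonsquare_by_def)
  have "iter_norm (diffs 1 (2 ^ j)) 0 \<le> (2 * (1 - \<delta>)) ^ j * s" for j
  proof (induction j)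
    case (Suc j)
    have "iter_norm (diffs 1 (2 ^ Suc j)) 0 \<le> 2 * (1 - \<delta>) * iter_norm (diffs 1 (2 ^ j)) 0"
      using iter_norm_diffs_double[OF ns, of "2 ^ j"] by simp
    also have "\<dots> \<le> 2 * (1 - \<delta>) * ((2 * (1 - \<delta>)) ^ j * s)"
      using \<delta> Suc by (intro mult_left_mono) auto
    finally show ?case by simp
  qed (simp add: s_def)
  moreover have "(\<lambda>j. (1 - \<delta>) ^ j * s) \<longlonglongrightarrow> 0"
    using \<delta> by (intro tendsto_mult_left_zero LIMSEQ_realpow_zero) auto
  then obtain j where "(1 - \<delta>) ^ j * s < e"
    using \<open>e > 0\<close> order_tendstoD(2) eventually_sequentially by (metis order_refl)
  then have "2 ^ j * ((1 - \<delta>) ^ j * s) \<le> 2 ^ j * e" by simp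
  then have "(2 * (1 - \<delta>)) ^ j * s \<le> e * real (2 ^ j)"
    by (simp only: power_mult_distrib mult.assoc of_nat_power of_nat_numeral mult.commute[of e])
  ultimately show thesis using that[of "2 ^ j"] by (meson order_trans pos2 zero_less_power)
qed

lemma map2_plus_zeros:
  "length as = n \<Longrightarrow> map2 (+) (replicate n 0) as = (as :: real list)"
  "length as = n \<Longrightarrow> map2 (+) as (replicate n 0) = (as :: real list)"
  by (induction as arbitrary: n; force)+

lemma length_concat_replicate_pair [simp]: "length (concat (replicate m [a, b])) = 2 * m"
  by (induction m) auto

text \<open>Place the pair \<open>(t,-t)\<close> at \<open>m\<close> successive positions in front of the same \<open>post\<close> and add up: each
  summand has the same norm.\<close>

lemma iter_norm_average_diffs:
  "iter_norm (diffs t m @ map ((*) (real m)) post) (real m *\<^sub>R x) \<le> real m * iter_norm (t # (- t) # post) x"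
proof (induction m)
  case 0
  have "map ((*) 0) post = map (\<lambda>_. 0) post" by simp
  with iter_norm_scale[of 0 post x] show ?case by (simp only: of_nat_0) simp
next
  case (Suc m)
  let ?as = "[t, - t] @ replicate (2 * m) 0 @ post"
  let ?bs = "[0, 0] @ diffs t m @ map ((*) (real m)) post"
  have "map2 (+) post (map ((*) (real m)) post) = map ((*) (real (Suc m))) post"
    by (induction post) (auto simp: algebra_simps)
  then have eq: "map2 (+) ?as ?bs = diffs t (Suc m) @ map ((*) (real (Suc m))) post"
    by (simp add: map2_plus_zeros)
  have "iter_norm (map2 (+) ?as ?bs) (x + real m *\<^sub>R x) \<le> iter_norm ?as x + iter_norm ?bs (real m *\<^sub>R x)"
    by (rule iter_norm_triangle) simp
  also have "\<dots> \<le> iter_norm (t # (- t) # post) x + real m * iter_norm (t # (- t) # post) x"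
    using iter_norm_append_cong[OF iter_norm_zeros, of "[t, - t]"] Suc by simp
  also have "x + real m *\<^sub>R x = real (Suc m) *\<^sub>R x" by (simp add: scaleR_left_distrib)
  also have "iter_norm (t # (- t) # post) x + real m * iter_norm (t # (- t) # post) x
      = real (Suc m) * iter_norm (t # (- t) # post) x" by (simp add: distrib_right)
  finally show ?case unfolding eq .
qed

text \<open>The mean of the \<open>m\<close> summands above differs from \<open>post\<close> by \<open>t/m\<close> times an alternating sum of
  length \<open>2m\<close>, which is negligible because alternating sums grow sublinearly.\<close>

lemma iter_norm_delete_diff_head:
  assumes ns: "nonsquare_by \<delta> TYPE('a)"
  shows "iter_norm post x \<le> iter_norm (t # (- t) # post) x"
proof (rule field_le_epsilon)
  fix e :: real assume "e > 0"
  define e' where "e' = e / (\<bar>t\<bar> + 1)"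
  have "e' > 0" using \<open>e > 0\<close> by (simp add: e'_def)
  obtain m where m: "m > 0" "iter_norm (diffs 1 m) 0 \<le> e' * real m"
    using iter_norm_diffs_sublinear[OF ns \<open>e' > 0\<close>] .
  let ?post = "map ((*) (real m)) post"
  let ?as = "diffs t m @ ?post" and ?bs = "diffs (- t) m @ replicate (length post) 0"
  have "diffs (- t) m = map ((*) (- t)) (diffs 1 m)" by (induction m) auto
  then have bs: "iter_norm ?bs 0 = \<bar>t\<bar> * iter_norm (diffs 1 m) 0"
    using iter_norm_scale[of "- t" "diffs 1 m" 0] by (simp add: iter_norm_append_zeros)
  have "map2 (+) (diffs t m) (diffs (- t) m) = replicate (2 * m) 0" by (induction m) auto
  then have eq: "map2 (+) ?as ?bs = replicate (2 * m) 0 @ ?post"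
    by (simp add: map2_plus_zeros)
  have "real m * iter_norm post x = iter_norm (map2 (+) ?as ?bs) (real m *\<^sub>R x + 0)"
    unfolding eq by (simp add: iter_norm_zeros iter_norm_scale)
  also have "\<dots> \<le> iter_norm ?as (real m *\<^sub>R x) + iter_norm ?bs 0"
    by (rule iter_norm_triangle) simp
  also have "\<dots> \<le> real m * iter_norm (t # (- t) # post) x + \<bar>t\<bar> * (e' * real m)"
    unfolding bs by (intro add_mono mult_left_mono iter_norm_average_diffs m) auto
  finally have "real m * iter_norm post x \<le> real m * (iter_norm (t # (- t) # post) x + \<bar>t\<bar> * e')"
    by (simp add: algebra_simps)
  then have "iter_norm post x \<le> iter_norm (t # (- t) # post) x + \<bar>t\<bar> * e'"
    using m(1) by simp
  moreover have "\<bar>t\<bar> * e' \<le> e" using \<open>e > 0\<close> by (simp add: e'_def field_simps)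
  ultimately show "iter_norm post x \<le> iter_norm (t # (- t) # post) x + e" by linarith
qed

lemma iter_norm_delete_diff:
  assumes "nonsquare_by \<delta> TYPE('a)"
  shows "iter_norm (pre @ post) x \<le> iter_norm (pre @ t # (- t) # post) x"
  by (intro iter_norm_mono iter_norm_delete_diff_head[OF assms])

section \<open>Growth of zigzag sums\<close>

text \<open>In terms of partial sums, the list on the right repeats the pattern \<open>\<plusminus>2, 0\<close> and hence merges
  to a zigzag of double height, except for an excursion at the end that is deleted.\<close>

lemma iter_norm_zigzag_drop:
  assumes ns: "nonsquare_by \<delta> TYPE('a)"
  shows "iter_norm (map ((*) 2) ((- e) # zigzag (- e) n)) x \<le> iter_norm (split_diff (zigzag e (Suc n))) x"
proof (induction n arbitrary: e x)
  case 0
  show ?case using iter_norm_delete_diff[OF ns, of "[- 2 * e, 2 * e]" "[]" x e] by simp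
next
  case (Suc n)
  let ?rest = "zigzag e n"
  have "iter_norm ([- 2 * e, 2 * e] @ map ((*) 2) (e # ?rest)) x
      \<le> iter_norm ([- 2 * e, 2 * e] @ split_diff (zigzag (- e) (Suc n))) x"
    by (intro iter_norm_mono) (use Suc[of "- e"] in simp)
  moreover have "iter_norm ([- 2 * e, 2 * e] @ map ((*) 2) (e # ?rest))
      = iter_norm ((- 2 * e) # (4 * e) # map ((*) 2) ?rest)"
    by (simp, rule iter_norm_cong) (simp add: iter_norm_merge)
  ultimately show ?case by simp
qed

text \<open>Of the two interlaced copies of the longer zigzag, the sum has twice its norm, so nonsquareness
  makes the difference small; but the difference dominates twice the shorter zigzag.\<close>

lemma iter_norm_zigzag_step:
  assumes ns: "nonsquare_by \<delta> TYPE('a)"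
  shows "iter_norm (1 # zigzag 1 n) 0 \<le> (1 - \<delta>) * iter_norm (1 # zigzag 1 (Suc n)) 0"
proof -
  define as where "as = 1 # zigzag 1 (Suc n)"
  define u where "u = concat (map (\<lambda>a. [a, 0]) as)"
  define v where "v = concat (map (\<lambda>a. [0, a]) as)"
  define p where "p = iter_norm as 0"
  have "iter_norm u = iter_norm as" unfolding u_def by (induction as) (auto intro!: iter_norm_cong)
  then have Nu: "iter_norm u 0 = p" by (simp add: p_def)
  have "iter_norm v = iter_norm as" unfolding v_def by (induction as) (auto intro!: iter_norm_cong)
  then have Nv: "iter_norm v 0 = p" by (simp add: p_def)
  have len: "length u = length v" unfolding u_def v_def by (induction as) auto
  have "map2 (+) u v = concat (map (\<lambda>a. [a, a]) as)" unfolding u_def v_def by (induction as) auto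
  moreover have "iter_norm (concat (map (\<lambda>a. [a, a]) as)) = iter_norm (map ((*) 2) as)"
    by (induction as) (auto simp: iter_norm_merge intro!: iter_norm_cong)
  ultimately have plus: "iter_norm (map2 (+) u v) 0 = 2 * p"
    using iter_norm_scale[of 2 as 0] by (simp add: p_def)
  have minus: "map2 (-) u v = split_diff as" unfolding u_def v_def by (induction as) auto
  have "map ((*) 2) ((- 1) # zigzag (- 1) n) = map ((*) (- 2)) (1 # zigzag 1 n)"
    by (simp add: zigzag_uminus)
  then have "2 * iter_norm (1 # zigzag 1 n) 0 = iter_norm (map ((*) 2) ((- 1) # zigzag (- 1) n)) 0"
    using iter_norm_scale[of "- 2" "1 # zigzag 1 n" 0] by simp
  also have "\<dots> \<le> iter_norm (split_diff (zigzag 1 (Suc n))) 0"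
    by (rule iter_norm_zigzag_drop[OF ns])
  also have "\<dots> \<le> iter_norm (split_diff as) 0"
    using iter_norm_delete_diff_head[OF ns] by (simp add: as_def)
  finally have low: "2 * iter_norm (1 # zigzag 1 n) 0 \<le> iter_norm (split_diff as) 0" .
  have "min (2 * p) (iter_norm (split_diff as) 0) \<le> 2 * (1 - \<delta>) * p"
    using iter_norm_nonsquare[OF ns len, of 0 0] by (simp add: plus minus Nu Nv)
  moreover have "iter_norm (split_diff as) 0 \<le> 2 * p"
  proof -
    have "map2 (+) u (map ((*) (- 1)) v) = split_diff as"
      unfolding u_def v_def by (induction as) auto
    then show ?thesis
      using iter_norm_triangle[of u "map ((*) (- 1)) v" 0 0] iter_norm_scale[of "- 1" v 0] len
      by (simp add: Nu Nv)
  qed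
  ultimately have "iter_norm (split_diff as) 0 \<le> 2 * (1 - \<delta>) * p"
    by (simp add: min_def split: if_splits)
  with low have "iter_norm (1 # zigzag 1 n) 0 \<le> (1 - \<delta>) * p" by linarith
  then show ?thesis by (simp only: p_def as_def)
qed

text \<open>Iterating the previous estimate makes the norms of zigzags grow exponentially, whereas the sum of their
  coefficients permits only linear growth.\<close>

lemma iter_norm_diff_eq_0:
  assumes ns: "nonsquare_by \<delta> TYPE('a)"
  shows "iter_norm [1, - 1] 0 = 0"
proof -
  obtain B where B: "\<forall>\<^sub>F c in F. norm c \<le> B" using eventually_norm_le by blast
  have \<delta>: "0 < \<delta>" "\<delta> < 1" using ns by (auto simp: nonsquare_by_def)
  define p where "p n = iter_norm (1 # zigzag 1 n) 0" for n
  have "p 0 \<le> (1 - \<delta>) ^ n * p n" for n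
  proof (induction n)
    case (Suc n)
    have "p n \<le> (1 - \<delta>) * p (Suc n)" unfolding p_def by (rule iter_norm_zigzag_step[OF ns])
    then have "(1 - \<delta>) ^ n * p n \<le> (1 - \<delta>) ^ n * ((1 - \<delta>) * p (Suc n))"
      using \<delta> by (intro mult_left_mono) auto
    also have "\<dots> = (1 - \<delta>) ^ Suc n * p (Suc n)" by simp
    finally show ?case using Suc by linarith
  qed simp
  moreover have "(1 - \<delta>) ^ n * p n \<le> (1 - \<delta>) ^ n * (B * (2 * real n + 2))" for n
    using iter_norm_bound[OF B, of "1 # zigzag 1 n" 0] \<delta>
    by (intro mult_left_mono) (auto simp: p_def sum_list_abs_zigzag add.commute)
  ultimately have "p 0 \<le> (1 - \<delta>) ^ n * (B * (2 * real n + 2))" for n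
    by (meson order_trans)
  moreover have "(\<lambda>n. (1 - \<delta>) ^ n * (B * (2 * real n + 2))) \<longlonglongrightarrow> 0"
  proof -
    have "(\<lambda>n. 2 * B * (real n * (1 - \<delta>) ^ n) + 2 * B * (1 - \<delta>) ^ n) \<longlonglongrightarrow> 2 * B * 0 + 2 * B * 0"
      using \<delta> by (intro tendsto_intros powser_times_n_limit_0 LIMSEQ_realpow_zero) auto
    then show ?thesis by (simp add: algebra_simps)
  qed
  ultimately have "p 0 \<le> 0" by (intro LIMSEQ_le_const) auto
  then show ?thesis using iter_norm_nonneg[of "[1, - 1]" 0] by (simp add: p_def)
qed

lemma nonsquare_imp_cauchy_filter:
  assumes "nonsquare_by \<delta> TYPE('a)"
  shows "cauchy_filter F"
proof -
  have 0: "((\<lambda>c. iter_norm [- 1] c) \<longlongrightarrow> 0) F"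
    using iter_norm_tendsto[of "[- 1]" 0 1] iter_norm_diff_eq_0[OF assms] by simp
  have "\<exists>c. eventually (\<lambda>c'. dist c c' < e) F" if "e > 0" for e
  proof -
    obtain c where "iter_norm [- 1] c < e"
      using eventually_happens'[OF nontrivial order_tendstoD(2)[OF 0 \<open>e > 0\<close>]] by blast
    then have "\<forall>\<^sub>F c' in F. norm (c + (- 1) *\<^sub>R c') < e"
      using order_tendstoD(2)[OF iter_norm_tendsto[of "[]" c "- 1"]] by simp
    then show ?thesis by (auto simp: dist_norm)
  qed
  note * = this
  show ?thesis
    unfolding cauchy_filter_metric
  proof (intro allI impI)
    fix e :: real assume "e > 0"
    then obtain c where "eventually (\<lambda>c'. dist c c' < e / 2) F" using *[of "e / 2"] by auto
    moreover have "dist x y < e" if "dist c x < e / 2" "dist c y < e / 2" for x y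
      using dist_triangle_half_r that by blast
    ultimately show "\<exists>P. eventually P F \<and> (\<forall>x y. P x \<and> P y \<longrightarrow> dist x y < e)" by blast
  qed
qed

end

section \<open>Compactness of bounded closed convex sets\<close>

text \<open>A convex function \<open>G\<close> converges to the supremum \<open>l\<close> of its infima over the members of \<open>M\<close>: the
  sublevel set \<open>{G \<le> l + e}\<close> is closed, convex and meets every member, so it belongs to \<open>M\<close> by maximality.\<close>

lemma convex_ultrafilter_of_maximal_base:
  fixes M :: "'a::real_normed_vector set set"
  assumes base: "filter_base M" and sub: "M \<subseteq> {C. closed C \<and> convex C}"
    and max: "\<And>D. closed D \<Longrightarrow> convex D \<Longrightarrow> (\<And>A. A \<in> M \<Longrightarrow> A \<inter> D \<noteq> {}) \<Longrightarrow> D \<in> M"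
    and bdd: "\<exists>A\<in>M. bounded A"
  shows "convex_ultrafilter (INF A\<in>M. principal A)"
proof -
  define F where "F = (INF A\<in>M. principal A)"
  have ev: "eventually P F \<longleftrightarrow> (\<exists>A\<in>M. \<forall>x\<in>A. P x)" for P
    unfolding F_def
    by (subst eventually_INF_base) (use base in \<open>auto simp: filter_base_def eventually_principal\<close>)
  have meet: "A \<inter> B \<noteq> {}" if "A \<in> M" "B \<in> M" for A B
    using base that unfolding filter_base_def by (metis subset_empty)
  obtain A0 where A0: "A0 \<in> M" "bounded A0" using bdd by blast
  show ?thesis
    unfolding F_def[symmetric]
  proof
    show "F \<noteq> bot"
      using base unfolding trivial_limit_def ev filter_base_def by auto
  next
    fix P assume "eventually P F"
    then obtain A where "A \<in> M" "\<forall>x\<in>A. P x" using ev by blast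
    then show "\<exists>C. convex C \<and> eventually (\<lambda>c. c \<in> C) F \<and> (\<forall>c\<in>C. P c)"
      using sub by (intro exI[of _ A]) (auto simp: ev)
  next
    fix G :: "'a \<Rightarrow> real" and L assume G: "convex_on UNIV G" "L-lipschitz_on UNIV G"
    obtain b where b: "\<And>x. x \<in> A0 \<Longrightarrow> \<bar>G x\<bar> \<le> b"
    proof -
      obtain b where b: "\<And>x. x \<in> A0 \<Longrightarrow> norm x \<le> b" using A0(2) by (auto simp: bounded_iff)
      have "\<bar>G x\<bar> \<le> \<bar>G 0\<bar> + L * b" if "x \<in> A0" for x
      proof -
        have "\<bar>G x - G 0\<bar> \<le> L * norm x"
          using lipschitz_onD[OF G(2), of x 0] by (simp add: dist_real_def)
        also have "\<dots> \<le> L * b" using b[OF that] lipschitz_on_nonneg[OF G(2)] by (intro mult_left_mono)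
        finally show ?thesis by linarith
      qed
      then show ?thesis using that by blast
    qed
    define R where "R = {r. \<exists>A\<in>M. \<forall>x\<in>A. r \<le> G x}"
    have ub: "r \<le> b" if rR: "r \<in> R" for r
    proof -
      obtain A where A: "A \<in> M" "\<forall>x\<in>A. r \<le> G x" using rR by (auto simp: R_def)
      obtain x where "x \<in> A" "x \<in> A0" using meet[OF A(1) A0(1)] by blast
      then show ?thesis using A(2) b[of x] by force
    qed
    have "- b \<le> G x" if "x \<in> A0" for x using b[OF that] by linarith
    then have "- b \<in> R" using A0(1) unfolding R_def by blast
    then have ne: "R \<noteq> {}" by blast
    have bddR: "bdd_above R" by (rule bdd_aboveI) (rule ub)
    define l where "l = Sup R"
    have "(G \<longlongrightarrow> l) F"
    proof (rule tendstoI)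
      fix e :: real assume "e > 0"
      then obtain r where r: "r \<in> R" "l - e < r"
        using less_cSup_iff[OF ne bddR, of "l - e"] by (auto simp: l_def)
      from r(1) obtain A where A: "A \<in> M" "\<forall>x\<in>A. r \<le> G x" unfolding R_def by blast
      define D where "D = {x. G x \<le> l + e / 2}"
      have "continuous_on UNIV G" using G(2) lipschitz_on_continuous_on by blast
      then have "closed D" unfolding D_def by (intro closed_Collect_le continuous_intros)
      moreover have "convex D"
      proof (rule convexI)
        fix x y and u v :: real
        assume *: "x \<in> D" "y \<in> D" "0 \<le> u" "0 \<le> v" "u + v = 1"
        then have "G (u *\<^sub>R x + v *\<^sub>R y) \<le> u * G x + v * G y"
          using G(1) unfolding convex_on_def by simp
        also have "\<dots> \<le> l + e / 2" using * by (intro convex_bound_le) (auto simp: D_def)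
        finally show "u *\<^sub>R x + v *\<^sub>R y \<in> D" by (simp add: D_def)
      qed
      moreover have "B \<inter> D \<noteq> {}" if "B \<in> M" for B
      proof
        assume "B \<inter> D = {}"
        have "l + e / 2 \<le> G x" if "x \<in> B" for x
        proof -
          have "x \<notin> D" using \<open>B \<inter> D = {}\<close> \<open>x \<in> B\<close> by blast
          then show ?thesis by (simp add: D_def)
        qed
        then have "l + e / 2 \<in> R" using \<open>B \<in> M\<close> unfolding R_def by blast
        then have "l + e / 2 \<le> l" unfolding l_def by (intro cSup_upper bddR)
        then show False using \<open>e > 0\<close> by simp
      qed
      ultimately have "D \<in> M" by (rule max)
      then have "eventually (\<lambda>x. x \<in> D) F" "eventually (\<lambda>x. x \<in> A) F"
        unfolding ev by (auto intro: A(1))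
      then show "\<forall>\<^sub>F x in F. dist (G x) l < e"
      proof eventually_elim
        case (elim x)
        then have "r \<le> G x" "G x \<le> l + e / 2" using A(2) by (auto simp: D_def)
        then show ?case using r(2) \<open>e > 0\<close> by (auto simp: dist_real_def abs_less_iff)
      qed
    qed
    then show "\<exists>l. (G \<longlongrightarrow> l) F" by blast
  next
    show "\<exists>B. \<forall>\<^sub>F c in F. norm c \<le> B"
      using A0 unfolding ev bounded_iff by blast
  qed
qed

text \<open>This is the form in which reflexivity of the space is used (Smulian's criterion).\<close>

theorem nonsquare_closed_convex_compactness:
  fixes \<A> :: "'a::banach set set"
  assumes ns: "nonsquare_by \<delta> TYPE('a)" and base: "filter_base \<A>"
    and cc: "\<And>A. A \<in> \<A> \<Longrightarrow> closed A" "\<And>A. A \<in> \<A> \<Longrightarrow> convex A"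
    and bdd: "\<exists>A\<in>\<A>. bounded A"
  obtains x where "\<And>A. A \<in> \<A> \<Longrightarrow> x \<in> A"
proof -
  let ?S = "{C :: 'a set. closed C \<and> convex C}"
  have "\<A> \<subseteq> ?S" using cc by auto
  from maximal_filter_base[OF base this] obtain M where M: "filter_base M" "\<A> \<subseteq> M" "M \<subseteq> ?S"
    and max: "\<And>D. D \<in> ?S \<Longrightarrow> (\<And>A. A \<in> M \<Longrightarrow> A \<inter> D \<noteq> {}) \<Longrightarrow> D \<in> M"
    by (metis (no_types, lifting) closed_Int convex_Int mem_Collect_eq)
  define F where "F = (INF A\<in>M. principal A)"
  interpret convex_ultrafilter F
    unfolding F_def using M bdd by (intro convex_ultrafilter_of_maximal_base max) auto
  obtain x where x: "F \<le> nhds x"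
    using nonsquare_imp_cauchy_filter[OF ns] complete_UNIV nontrivial unfolding complete_uniform by auto
  have "x \<in> A" if "A \<in> \<A>" for A
  proof -
    have "A \<in> M" using M(2) that by blast
    then have "F \<le> principal A" unfolding F_def by (rule INF_lower)
    then have "eventually (\<lambda>y. y \<in> A) F" by (simp add: le_principal)
    moreover have "((\<lambda>y. y) \<longlongrightarrow> x) F" using x by (simp add: filterlim_def)
    ultimately show "x \<in> A" by (intro Lim_in_closed_set[OF cc(1)[OF that] _ nontrivial])
  qed
  then show thesis by (rule that)
qed

lemma filter_base_atLeast: "filter_base (range (atLeast :: nat \<Rightarrow> nat set))"
  unfolding filter_base_def
proof (intro conjI ballI)
  fix A B :: "nat set" assume "A \<in> range atLeast" "B \<in> range atLeast"
  then obtain m n where "A = {m..}" "B = {n..}" by auto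
  then show "\<exists>D\<in>range atLeast. D \<subseteq> A \<inter> B" by (intro bexI[of _ "{max m n..}"]) auto
qed auto

text \<open>For a free ultrafilter \<open>\<B>\<close> in a reflexive space, \<open>p\<close> is the weak limit of \<open>x\<close> along \<open>\<B>\<close>.\<close>

lemma weak_cluster_point:
  fixes x :: "'i \<Rightarrow> 'a::banach"
  assumes ns: "nonsquare_by \<delta> TYPE('a)" and base: "filter_base \<B>" and bdd: "bounded (range x)"
  obtains p where "\<And>B. B \<in> \<B> \<Longrightarrow> p \<in> closure (convex hull (x ` B))"
proof -
  define \<A> where "\<A> = (\<lambda>B. closure (convex hull (x ` B))) ` \<B>"
  have mono: "closure (convex hull (x ` B)) \<subseteq> closure (convex hull (x ` B'))" if "B \<subseteq> B'" for B B'
    using that by (intro closure_mono hull_mono image_mono)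
  have "\<exists>D\<in>\<A>. D \<subseteq> A1 \<inter> A2" if A12: "A1 \<in> \<A>" "A2 \<in> \<A>" for A1 A2
  proof -
    obtain B1 B2 where B: "B1 \<in> \<B>" "B2 \<in> \<B>" "A1 = closure (convex hull (x ` B1))"
      "A2 = closure (convex hull (x ` B2))" using A12 by (auto simp: \<A>_def)
    obtain D where "D \<in> \<B>" "D \<subseteq> B1 \<inter> B2" using base B(1,2) unfolding filter_base_def by blast
    then show ?thesis
      using B(3,4) mono[of D B1] mono[of D B2]
      by (intro bexI[of _ "closure (convex hull (x ` D))"]) (auto simp: \<A>_def)
  qed
  moreover have "\<A> \<noteq> {}" using base by (auto simp: \<A>_def filter_base_def)
  moreover have "A \<noteq> {}" if "A \<in> \<A>" for A
    using that base by (auto simp: \<A>_def filter_base_def)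
  then have "{} \<notin> \<A>" by blast
  ultimately have "filter_base \<A>" unfolding filter_base_def by blast
  moreover have "closed A" "convex A" if "A \<in> \<A>" for A
    using that by (auto simp: \<A>_def convex_closure)
  moreover have "\<exists>A\<in>\<A>. bounded A"
  proof -
    obtain B where "B \<in> \<B>" using base by (auto simp: filter_base_def)
    moreover have "bounded (closure (convex hull (x ` B)))"
      by (intro bounded_closure bounded_convex_hull bounded_subset[OF bdd]) auto
    ultimately show ?thesis by (auto simp: \<A>_def)
  qed
  ultimately obtain p where "\<And>A. A \<in> \<A> \<Longrightarrow> p \<in> A"
    using nonsquare_closed_convex_compactness[OF ns] by metis
  then show thesis by (intro that[of p]) (auto simp only: \<A>_def intro: imageI)
qed

text \<open>A weak limit \<open>p\<close> of \<open>x\<close> is completed to a weak limit \<open>(p, q)\<close> of the pairs \<open>(x, y)\<close>; this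
  permits bounding \<open>q - p\<close> by bounds on \<open>y - x\<close>. Compactness in the second factor suffices: it is applied to
  the convex combinations of \<open>y\<close> whose companions formed from \<open>x\<close> are close to \<open>p\<close>.\<close>

lemma joint_weak_cluster_point:
  fixes x y :: "'i \<Rightarrow> 'a::banach"
  assumes ns: "nonsquare_by \<delta> TYPE('a)" and base: "filter_base \<B>" and bdd: "bounded (range y)"
    and p: "\<And>B. B \<in> \<B> \<Longrightarrow> p \<in> closure (convex hull (x ` B))"
  obtains q where "\<And>B e. B \<in> \<B> \<Longrightarrow> e > 0 \<Longrightarrow>
      \<exists>(a, b)\<in>convex hull ((\<lambda>i. (x i, y i)) ` B). dist a p < e \<and> dist b q < e"
    and "\<And>B. B \<in> \<B> \<Longrightarrow> q \<in> closure (convex hull (y ` B))"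
proof -
  define H where "H B = convex hull ((\<lambda>i. (x i, y i)) ` B)" for B
  define D where "D B e = snd ` (H B \<inter> ball p e \<times> UNIV)" for B and e :: real
  define \<A> where "\<A> = {closure (D B e) |B e. B \<in> \<B> \<and> e > 0}"
  have fstH: "fst ` H B = convex hull (x ` B)" and sndH: "snd ` H B = convex hull (y ` B)" for B
    unfolding H_def by (simp_all add: convex_hull_linear_image linear_fst linear_snd image_image)
  have mono: "closure (D B e) \<subseteq> closure (D B' e')" if "B \<subseteq> B'" "e \<le> e'" for B B' e e'
  proof -
    have "H B \<subseteq> H B'" unfolding H_def using that by (intro hull_mono image_mono)
    then show ?thesis unfolding D_def using that by (intro closure_mono image_mono) auto
  qed
  have ne: "D B e \<noteq> {}" if Be: "B \<in> \<B>" "e > 0" for B e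
  proof -
    obtain a where "a \<in> convex hull (x ` B)" "dist a p < e"
      using p[OF Be(1)] Be(2) by (auto simp: closure_approachable)
    then obtain z where "z \<in> H B" "fst z = a" using fstH[of B] by (metis imageE)
    then have "z \<in> H B \<inter> ball p e \<times> UNIV" using \<open>dist a p < e\<close> by (auto simp: mem_Times_iff dist_commute)
    then show ?thesis unfolding D_def by blast
  qed
  have "\<exists>E\<in>\<A>. E \<subseteq> A1 \<inter> A2" if A12: "A1 \<in> \<A>" "A2 \<in> \<A>" for A1 A2
  proof -
    obtain B1 e1 B2 e2 where B: "B1 \<in> \<B>" "B2 \<in> \<B>" "e1 > 0" "e2 > 0"
      "A1 = closure (D B1 e1)" "A2 = closure (D B2 e2)" using A12 by (auto simp: \<A>_def)
    obtain B where B': "B \<in> \<B>" "B \<subseteq> B1 \<inter> B2" using base B(1,2) unfolding filter_base_def by blast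
    have "closure (D B (min e1 e2)) \<subseteq> A1 \<inter> A2"
      using mono[of B B1 "min e1 e2" e1] mono[of B B2 "min e1 e2" e2] B B' by auto
    moreover have "closure (D B (min e1 e2)) \<in> \<A>"
      unfolding \<A>_def using B B' by (intro CollectI exI[of _ B] exI[of _ "min e1 e2"]) auto
    ultimately show ?thesis by blast
  qed
  moreover obtain B0 where "B0 \<in> \<B>" using base by (auto simp: filter_base_def)
  then have B0: "closure (D B0 1) \<in> \<A>" unfolding \<A>_def using zero_less_one by blast
  moreover have "A \<noteq> {}" if "A \<in> \<A>" for A using that ne by (auto simp: \<A>_def)
  then have "{} \<notin> \<A>" by blast
  ultimately have "filter_base \<A>" unfolding filter_base_def by blast
  moreover have "closed A" "convex A" if "A \<in> \<A>" for A
  proof -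
    have "convex (D B e)" for B e
      unfolding D_def H_def
      by (intro convex_linear_image linear_snd convex_Int convex_convex_hull convex_Times convex_ball convex_UNIV)
    then show "closed A" "convex A" using that by (auto simp: \<A>_def convex_closure)
  qed
  moreover have "\<exists>A\<in>\<A>. bounded A"
  proof (rule bexI[OF _ B0])
    have "D B0 1 \<subseteq> convex hull (y ` B0)" unfolding D_def sndH[symmetric] by auto
    moreover have "bounded (convex hull (y ` B0))"
      by (intro bounded_convex_hull bounded_subset[OF bdd]) auto
    ultimately show "bounded (closure (D B0 1))" by (intro bounded_closure) (rule bounded_subset)
  qed
  ultimately obtain q where q: "\<And>A. A \<in> \<A> \<Longrightarrow> q \<in> A"
    using nonsquare_closed_convex_compactness[OF ns] by metis
  have "\<exists>(a, b)\<in>H B. dist a p < e \<and> dist b q < e" if Be: "B \<in> \<B>" "e > 0" for B e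
  proof -
    have "q \<in> closure (D B e)" using q Be by (auto simp: \<A>_def)
    then obtain b where "b \<in> D B e" "dist b q < e" using Be(2) by (auto simp: closure_approachable)
    then show ?thesis by (force simp: D_def dist_commute)
  qed
  moreover have "q \<in> closure (convex hull (y ` B))" if "B \<in> \<B>" for B
  proof -
    have "q \<in> closure (D B 1)" using q that zero_less_one unfolding \<A>_def by blast
    moreover have "D B 1 \<subseteq> convex hull (y ` B)" unfolding D_def sndH[symmetric] by auto
    ultimately show ?thesis using closure_mono by blast
  qed
  ultimately show thesis using that unfolding H_def by blast
qed

section \<open>Minimal invariant sets\<close>

definition minimal_invariant :: "('a::real_normed_vector \<Rightarrow> 'a) \<Rightarrow> 'a set \<Rightarrow> bool" where
  "minimal_invariant T K \<longleftrightarrow> K \<noteq> {} \<and> closed K \<and> convex K \<and> T ` K \<subseteq> K \<and>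
     (\<forall>L. L \<noteq> {} \<longrightarrow> closed L \<longrightarrow> convex L \<longrightarrow> T ` L \<subseteq> L \<longrightarrow> L \<subseteq> K \<longrightarrow> L = K)"

lemma minimal_invariant_exists:
  fixes C :: "'a::banach set"
  assumes ns: "nonsquare_by \<delta> TYPE('a)"
    and C: "C \<noteq> {}" "closed C" "bounded C" "convex C" "T ` C \<subseteq> C"
  obtains K where "minimal_invariant T K" "K \<subseteq> C"
proof -
  define \<S> where "\<S> = {L. closed L \<and> convex L \<and> T ` L \<subseteq> L}"
  have "filter_base {C}" "{C} \<subseteq> \<S>" using C by (auto simp: filter_base_def \<S>_def)
  moreover have "A \<inter> B \<in> \<S>" if "A \<in> \<S>" "B \<in> \<S>" for A B
    using that by (auto simp: \<S>_def intro: closed_Int convex_Int)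
  ultimately obtain M where M: "filter_base M" "{C} \<subseteq> M" "M \<subseteq> \<S>"
    and max: "\<And>D. D \<in> \<S> \<Longrightarrow> (\<And>A. A \<in> M \<Longrightarrow> A \<inter> D \<noteq> {}) \<Longrightarrow> D \<in> M"
    using maximal_filter_base[of "{C}" \<S>] by metis
  define K where "K = \<Inter>M"
  have "closed A" "convex A" if "A \<in> M" for A using M(3) that by (auto simp: \<S>_def)
  then obtain x where "\<And>A. A \<in> M \<Longrightarrow> x \<in> A"
    using nonsquare_closed_convex_compactness[OF ns M(1)] M(2) C(3) by (metis insert_subset)
  then have "K \<noteq> {}" by (auto simp: K_def)
  moreover have "closed K" "convex K" "T ` K \<subseteq> K" and KC: "K \<subseteq> C"
    using M(2,3) by (auto simp: K_def \<S>_def intro!: closed_Inter convex_Inter)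
  moreover have "L = K" if L: "L \<noteq> {}" "closed L" "convex L" "T ` L \<subseteq> L" "L \<subseteq> K" for L
  proof -
    have "A \<inter> L \<noteq> {}" if "A \<in> M" for A using that L by (auto simp: K_def)
    then have "L \<in> M" by (intro max) (use L in \<open>auto simp: \<S>_def\<close>)
    then show ?thesis using L(5) by (auto simp: K_def)
  qed
  ultimately have "minimal_invariant T K" unfolding minimal_invariant_def by blast
  from that[OF this KC] show thesis .
qed

text \<open>The centres \<open>y\<close> of balls of radius \<open>s\<close> that contain \<open>K\<close> form an invariant set: by minimality
  \<open>K\<close> is the closed convex hull of \<open>T K\<close>, and \<open>T K\<close> lies in the ball around \<open>T y\<close>. Hence all
  points of \<open>K\<close> are such centres.\<close>

lemma minimal_invariant_diametral:
  assumes K: "minimal_invariant T K" and T: "nonexpansive_on K T"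
    and y: "y \<in> K" "K \<subseteq> cball y s" and uv: "u \<in> K" "v \<in> K"
  shows "dist u v \<le> s"
proof -
  have K': "closed K" "convex K" "T ` K \<subseteq> K"
    and min: "\<And>L. L \<noteq> {} \<Longrightarrow> closed L \<Longrightarrow> convex L \<Longrightarrow> T ` L \<subseteq> L \<Longrightarrow> L \<subseteq> K \<Longrightarrow> L = K"
    using K by (auto simp: minimal_invariant_def)
  have hull: "closure (convex hull (T ` K)) = K"
  proof (rule min)
    show sub: "closure (convex hull (T ` K)) \<subseteq> K"
      using K' by (intro closure_minimal hull_minimal)
    have "T ` K \<subseteq> closure (convex hull (T ` K))" by (meson closure_subset hull_subset order_trans)
    then show "T ` closure (convex hull (T ` K)) \<subseteq> closure (convex hull (T ` K))" using sub by blast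
  qed (use y in \<open>auto simp: convex_closure\<close>)
  define L where "L = K \<inter> (\<Inter>z\<in>K. cball z s)"
  have "L = K"
  proof (rule min)
    have "y \<in> L" using y by (auto simp: L_def dist_commute subset_iff)
    then show "L \<noteq> {}" by blast
    show "closed L" unfolding L_def by (intro closed_Int closed_INT K') auto
    show "convex L" unfolding L_def by (intro convex_Int convex_INT K') auto
    show "T ` L \<subseteq> L"
    proof
      fix w assume "w \<in> T ` L"
      then obtain x where x: "x \<in> L" "w = T x" by blast
      then have "dist (T x) (T z) \<le> s" if "z \<in> K" for z
        using T that unfolding nonexpansive_on_def L_def dist_norm
        by (smt (verit) IntD1 IntD2 INT_E dist_norm mem_cball norm_minus_commute)
      then have "closure (convex hull (T ` K)) \<subseteq> cball w s"
        using x by (intro closure_minimal hull_minimal) auto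
      then show "w \<in> L" using x K'(3) unfolding hull L_def by (auto simp: dist_commute)
    qed
  qed (auto simp: L_def)
  then have "v \<in> L" using uv by simp
  then have "v \<in> cball u s" using uv by (simp add: L_def)
  then show ?thesis by simp
qed

text \<open>Otherwise approximate fixed points \<open>z\<^sub>n\<close> stay within \<open>r\<close> of \<open>y\<close>. The points with this property, in
  the limit, form an invariant set, hence all of \<open>K\<close>; a weak cluster point of \<open>z\<^sub>n\<close> is then the centre of a ball
  of radius \<open>r\<close> containing \<open>K\<close>, and \<open>K\<close> has diameter at most \<open>r\<close>.\<close>

lemma goebel_karlovitz:
  fixes K :: "'a::banach set"
  assumes ns: "nonsquare_by \<delta> TYPE('a)" and K: "minimal_invariant T K" and T: "nonexpansive_on K T"
    and bdd: "bounded K" and y: "y \<in> K" and r: "r < diameter K"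
  shows "\<exists>e>0. \<forall>z\<in>K. dist (T z) z \<le> e \<longrightarrow> r \<le> dist z y"
proof (rule ccontr)
  assume no: "\<not> ?thesis"
  have "\<exists>z\<in>K. dist (T z) z \<le> e \<and> dist z y < r" if "e > 0" for e
    using no that by (meson not_le)
  then have "\<exists>z. z \<in> K \<and> dist (T z) z \<le> inverse (Suc n) \<and> dist z y < r" for n
    by (meson inverse_positive_iff_positive of_nat_0_less_iff zero_less_Suc)
  then obtain z where z: "\<And>n. z n \<in> K" "\<And>n. dist (T (z n)) (z n) \<le> inverse (Suc n)" "\<And>n. dist (z n) y < r"
    by metis
  have K': "closed K" "convex K" "T ` K \<subseteq> K"
    and min: "\<And>L. L \<noteq> {} \<Longrightarrow> closed L \<Longrightarrow> convex L \<Longrightarrow> T ` L \<subseteq> L \<Longrightarrow> L \<subseteq> K \<Longrightarrow> L = K"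
    using K by (auto simp: minimal_invariant_def)
  define L where "L = {v \<in> K. \<forall>s>r. \<exists>N. \<forall>n\<ge>N. dist (z n) v \<le> s}"
  have "L = K"
  proof (rule min)
    have "dist (z n) y \<le> s" if "s > r" for s n using z(3)[of n] that by linarith
    then have "y \<in> L" using y by (simp add: L_def)
    then show "L \<noteq> {}" by blast
    show "convex L"
    proof (rule convexI)
      fix v w and a b :: real assume vw: "v \<in> L" "w \<in> L" and ab: "0 \<le> a" "0 \<le> b" "a + b = 1"
      have "\<exists>N. \<forall>n\<ge>N. dist (z n) (a *\<^sub>R v + b *\<^sub>R w) \<le> s" if "s > r" for s
      proof -
        obtain N1 where N1: "\<forall>n\<ge>N1. dist (z n) v \<le> s" using vw(1) \<open>s > r\<close> unfolding L_def by blast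
        obtain N2 where N2: "\<forall>n\<ge>N2. dist (z n) w \<le> s" using vw(2) \<open>s > r\<close> unfolding L_def by blast
        have "a *\<^sub>R v + b *\<^sub>R w \<in> cball (z n) s" if "n \<ge> max N1 N2" for n
          using that N1 N2 ab convex_cball by (intro convexD) auto
        then show ?thesis by (intro exI[of _ "max N1 N2"]) simp
      qed
      then show "a *\<^sub>R v + b *\<^sub>R w \<in> L" using vw ab K'(2) by (auto simp: L_def convexD)
    qed
    show "closed L"
      unfolding closure_subset_eq[symmetric] subset_iff closure_approachable
    proof (intro allI impI)
      fix v assume v: "\<forall>e>0. \<exists>w\<in>L. dist w v < e"
      then have "\<forall>e>0. \<exists>w\<in>K. dist w v < e" by (auto simp: L_def)
      then have "v \<in> K" using K'(1) closed_approachable by blast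
      moreover have "\<exists>N. \<forall>n\<ge>N. dist (z n) v \<le> s" if "s > r" for s
      proof -
        obtain w where w: "w \<in> L" "dist w v < (s - r) / 2" using v \<open>s > r\<close> by (meson half_gt_zero diff_gt_0_iff_gt)
        have "r + (s - r) / 2 > r" using that by simp
        then obtain N where "\<And>n. n \<ge> N \<Longrightarrow> dist (z n) w \<le> r + (s - r) / 2" using w(1) unfolding L_def by blast
        then have "dist (z n) v \<le> s" if "n \<ge> N" for n
          using that w(2) dist_triangle[of "z n" v w] by (smt (verit) field_sum_of_halves)
        then show ?thesis by blast
      qed
      ultimately show "v \<in> L" by (simp add: L_def)
    qed
    show "T ` L \<subseteq> L"
    proof
      fix w assume "w \<in> T ` L"
      then obtain v where v: "v \<in> L" "w = T v" by blast
      have "\<exists>N. \<forall>n\<ge>N. dist (z n) w \<le> s" if "s > r" for s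
      proof -
        define h where "h = (s - r) / 2"
        have h: "h > 0" "s = (r + h) + h" using that by (auto simp: h_def field_simps)
        have "r + h > r" using h by simp
        then obtain N1 where N1: "\<And>n. n \<ge> N1 \<Longrightarrow> dist (z n) v \<le> r + h"
          using v(1) unfolding L_def by blast
        obtain N2 where N2: "inverse (Suc N2) < h" using reals_Archimedean[OF h(1)] by blast
        have "dist (z n) w \<le> s" if "n \<ge> max N1 N2" for n
        proof -
          have "dist (T (z n)) (z n) \<le> h"
          proof -
            have "inverse (real (Suc n)) \<le> inverse (Suc N2)" using that by (intro le_imp_inverse_le) auto
            then show ?thesis using z(2)[of n] N2 by linarith
          qed
          moreover have "dist (T (z n)) (T v) \<le> dist (z n) v"
            using T z(1) v(1) by (auto simp: nonexpansive_on_def dist_norm L_def)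
          moreover have "dist (z n) v \<le> r + h" using N1 that by simp
          ultimately show ?thesis
            using dist_triangle[of "z n" "T v" "T (z n)"] h(2) by (simp add: v(2) dist_commute)
        qed
        then show ?thesis by blast
      qed
      then show "w \<in> L" using v K'(3) by (auto simp: L_def)
    qed
  qed (auto simp: L_def)
  have "range z \<subseteq> K" using z(1) by auto
  then obtain p where p: "\<And>N::nat. p \<in> closure (convex hull (z ` {N..}))"
    using weak_cluster_point[OF ns filter_base_atLeast, of z] bounded_subset[OF bdd] by (metis rangeI)
  have "closure (convex hull (z ` {0..})) \<subseteq> K"
    using z(1) K' by (intro closure_minimal hull_minimal) auto
  then have pK: "p \<in> K" using p by blast
  have "dist p v \<le> s" if vs: "v \<in> K" "s > r" for v s
  proof -
    have "v \<in> L" using vs \<open>L = K\<close> by simp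
    then obtain N where "\<And>n. n \<ge> N \<Longrightarrow> dist (z n) v \<le> s" using vs(2) unfolding L_def by blast
    then have "closure (convex hull (z ` {N..})) \<subseteq> cball v s"
      by (intro closure_minimal hull_minimal) (auto simp: dist_commute)
    then show ?thesis using p[of N] by (auto simp: dist_commute)
  qed
  then have "K \<subseteq> cball p s" if "s > r" for s using that by auto
  then have "dist u v \<le> s" if "s > r" "u \<in> K" "v \<in> K" for s u v
    using minimal_invariant_diametral[OF K T pK] that by blast
  then have "diameter K \<le> s" if "s > r" for s
    using that y by (intro diameter_le) (auto simp: dist_norm)
  then show False using r dense by (meson less_le_not_le not_le)
qed

lemma resolvent_exists:
  fixes K :: "'a::banach set"
  assumes K: "closed K" "convex K" "T ` K \<subseteq> K" and T: "nonexpansive_on K T"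
    and f: "f \<in> K" and s: "0 < s" "s \<le> 1"
  obtains w where "w \<in> K" "w = (1 - s) *\<^sub>R T w + s *\<^sub>R f"
proof -
  have "\<exists>!w\<in>K. (1 - s) *\<^sub>R T w + s *\<^sub>R f = w"
  proof (rule Banach_fix)
    show "complete K" using K(1) by (simp add: complete_eq_closed)
    show "(\<lambda>w. (1 - s) *\<^sub>R T w + s *\<^sub>R f) ` K \<subseteq> K"
      using K f s by (auto intro!: convexD)
    fix x y assume "x \<in> K" "y \<in> K"
    then have "norm (T x - T y) \<le> norm (x - y)" using T by (simp add: nonexpansive_on_def)
    then have "(1 - s) * norm (T x - T y) \<le> (1 - s) * norm (x - y)" using s by (intro mult_left_mono) auto
    then show "dist ((1 - s) *\<^sub>R T x + s *\<^sub>R f) ((1 - s) *\<^sub>R T y + s *\<^sub>R f) \<le> (1 - s) * dist x y"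
      using s by (simp add: dist_norm flip: scaleR_diff_right)
  qed (use s f in auto)
  then show thesis using that by metis
qed

section \<open>The fixed point property\<close>

lemma free_ultrafilter_exists:
  obtains U :: "nat set set" where "filter_base U" "\<And>N. {N..} \<in> U" "\<And>D. D \<in> U \<or> - D \<in> U"
    "\<And>A B. A \<in> U \<Longrightarrow> B \<in> U \<Longrightarrow> A \<inter> B \<in> U"
proof -
  obtain U :: "nat set set" where U: "filter_base U" "range atLeast \<subseteq> U"
    and max: "\<And>D. (\<And>A. A \<in> U \<Longrightarrow> A \<inter> D \<noteq> {}) \<Longrightarrow> D \<in> U"
    using maximal_filter_base[OF filter_base_atLeast subset_UNIV] by (metis UNIV_I)
  have meet: "\<exists>E\<in>U. E \<noteq> {} \<and> E \<subseteq> A \<inter> B" if "A \<in> U" "B \<in> U" for A B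
    using U(1) that unfolding filter_base_def by metis
  have "A \<inter> B \<in> U" if AB: "A \<in> U" "B \<in> U" for A B
  proof (rule max)
    fix C assume "C \<in> U"
    obtain E where "E \<in> U" "E \<subseteq> A \<inter> B" using meet[OF AB] by blast
    with meet[OF \<open>C \<in> U\<close> \<open>E \<in> U\<close>] show "C \<inter> (A \<inter> B) \<noteq> {}" by blast
  qed
  moreover have "D \<in> U \<or> - D \<in> U" for D
  proof (rule disjCI)
    assume "- D \<notin> U"
    then obtain A where A: "A \<in> U" "A \<inter> - D = {}" using max by blast
    show "D \<in> U"
    proof (rule max)
      fix B assume "B \<in> U"
      from meet[OF this A(1)] A(2) show "B \<inter> D \<noteq> {}" by blast
    qed
  qed
  moreover have "{N..} \<in> U" for N using U(2) by blast
  ultimately show thesis using that U(1) by blast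
qed

text \<open>Convexity carries an estimate known for every \<open>w n\<close>, each on its own member of \<open>U\<close>, to convex
  combinations of the \<open>w n\<close>.\<close>

lemma convex_eventual_sublevel:
  fixes w :: "nat \<Rightarrow> 'a::real_normed_vector"
  assumes U: "\<And>A B. A \<in> U \<Longrightarrow> B \<in> U \<Longrightarrow> A \<inter> B \<in> U"
  shows "convex {v. \<exists>A\<in>U. \<forall>m\<in>A. norm (a - v + w m) \<le> c}"
proof (rule convexI)
  fix v v' and s t :: real
  assume "v \<in> {v. \<exists>A\<in>U. \<forall>m\<in>A. norm (a - v + w m) \<le> c}"
    "v' \<in> {v. \<exists>A\<in>U. \<forall>m\<in>A. norm (a - v + w m) \<le> c}" and st: "0 \<le> s" "0 \<le> t" "s + t = 1"
  then obtain A B where A: "A \<in> U" "\<And>m. m \<in> A \<Longrightarrow> v \<in> cball (a + w m) c"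
    and B: "B \<in> U" "\<And>m. m \<in> B \<Longrightarrow> v' \<in> cball (a + w m) c"
    by (auto simp: dist_norm algebra_simps)
  have "s *\<^sub>R v + t *\<^sub>R v' \<in> cball (a + w m) c" if "m \<in> A \<inter> B" for m
    using that st A(2) B(2) convex_cball by (intro convexD) auto
  then have "\<forall>m\<in>A \<inter> B. norm (a - (s *\<^sub>R v + t *\<^sub>R v') + w m) \<le> c"
    by (simp add: dist_norm algebra_simps)
  then show "s *\<^sub>R v + t *\<^sub>R v' \<in> {v. \<exists>A\<in>U. \<forall>m\<in>A. norm (a - v + w m) \<le> c}"
    using U[OF A(1) B(1)] by blast
qed

lemma approximate_fixed_points:
  fixes K :: "'a::banach set"
  assumes K: "closed K" "convex K" "T ` K \<subseteq> K" "bounded K" "K \<noteq> {}" and T: "nonexpansive_on K T"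
    and e: "e > 0"
  obtains x where "x \<in> K" "dist (T x) x \<le> e"
proof -
  obtain f where f: "f \<in> K" using K(5) by blast
  define s where "s = min 1 (e / (diameter K + 1))"
  have d0: "diameter K \<ge> 0" using K(4) by (rule diameter_ge_0)
  then have s: "0 < s" "s \<le> 1" using e by (auto simp: s_def)
  obtain x where x: "x \<in> K" "x = (1 - s) *\<^sub>R T x + s *\<^sub>R f"
    using resolvent_exists[OF K(1-3) T f s] .
  have "T x - x = s *\<^sub>R (T x - f)" using x(2) by (simp add: algebra_simps)
  then have "dist (T x) x = s * dist (T x) f" using s by (simp add: dist_norm)
  also have "\<dots> \<le> e / (diameter K + 1) * (diameter K + 1)"
    using s d0 e diameter_bounded_bound[OF K(4), of "T x" f] x(1) f K(3)
    by (intro mult_mono) (auto simp: s_def)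
  finally show thesis using that[OF x(1)] d0 by simp
qed

text \<open>Fixed points of the averaged maps \<open>w \<mapsto> (1-s) T w + s f\<^sub>n\<close> with \<open>f\<^sub>n = (x\<^sub>n + p)/2\<close> inherit half of the
  distances between the anchors \<open>x\<^sub>n\<close>, yet are approximate fixed points of \<open>T\<close> and so almost
  diametral to \<open>p\<close>. These competing demands produce a square.\<close>

lemma minimal_invariant_diameter_0:
  fixes K :: "'a::banach set"
  assumes ns: "nonsquare_by \<delta> TYPE('a)" and K: "minimal_invariant T K" and T: "nonexpansive_on K T"
    and bdd: "bounded K"
  shows "diameter K = 0"
proof (rule ccontr)
  assume "diameter K \<noteq> 0"
  define d where "d = diameter K"
  have d: "d > 0" using \<open>diameter K \<noteq> 0\<close> diameter_ge_0[OF bdd] by (simp add: d_def)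
  have \<delta>: "0 < \<delta>" "\<delta> < 1" using ns by (auto simp: nonsquare_by_def)
  have K': "closed K" "convex K" "T ` K \<subseteq> K" "K \<noteq> {}"
    using K by (auto simp: minimal_invariant_def)
  have le_d: "norm (u - v) \<le> d" if "u \<in> K" "v \<in> K" for u v
    using diameter_bounded_bound[OF bdd that] by (simp add: d_def dist_norm)
  have Tle: "norm (T u - T v) \<le> norm (u - v)" if "u \<in> K" "v \<in> K" for u v
    using T that by (simp add: nonexpansive_on_def)
  obtain U :: "nat set set" where U: "filter_base U" "\<And>N. {N..} \<in> U" "\<And>D. D \<in> U \<or> - D \<in> U"
    "\<And>A B. A \<in> U \<Longrightarrow> B \<in> U \<Longrightarrow> A \<inter> B \<in> U" using free_ultrafilter_exists by blast
  have "\<exists>x. x \<in> K \<and> dist (T x) x \<le> inverse (Suc n)" for n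
    using approximate_fixed_points[OF K'(1-3) bdd K'(4) T, of "inverse (Suc n)"]
    by (metis inverse_positive_iff_positive of_nat_0_less_iff zero_less_Suc)
  then obtain x where x: "\<And>n. x n \<in> K" "\<And>n. norm (T (x n) - x n) \<le> inverse (Suc n)"
    unfolding dist_norm by metis
  have bx: "bounded (range x)" using x(1) by (intro bounded_subset[OF bdd]) auto
  obtain p where p: "\<And>B. B \<in> U \<Longrightarrow> p \<in> closure (convex hull (x ` B))"
    using weak_cluster_point[OF ns U(1) bx] by blast
  have pK: "p \<in> K"
  proof -
    have "closure (convex hull (x ` {0..})) \<subseteq> K" using x(1) K' by (intro closure_minimal hull_minimal) auto
    then show ?thesis using p[OF U(2)[of 0]] by blast
  qed
  \<comment> \<open>Half of the gain \<open>\<delta> d\<close> from nonsquareness is kept to absorb approximation errors.\<close>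
  define r where "r = d - \<delta> * d / 2"
  have "r < diameter K" using d \<delta> by (simp add: r_def d_def)
  then obtain e where e: "e > 0" and far: "\<And>z. z \<in> K \<Longrightarrow> norm (T z - z) \<le> e \<Longrightarrow> r \<le> norm (z - p)"
    using goebel_karlovitz[OF ns K T bdd pK] unfolding dist_norm by blast
  \<comment> \<open>Small enough that the solutions \<open>w\<close> below are moved by \<open>T\<close> by at most \<open>e\<close>.\<close>
  define s where "s = min 1 (e / d)"
  have s: "0 < s" "s \<le> 1" "s * d \<le> e"
    using e d by (auto simp: s_def min_def field_simps)
  define f where "f n = (1/2) *\<^sub>R x n + (1/2) *\<^sub>R p" for n
  have fK: "f n \<in> K" for n
    unfolding f_def using x(1) pK K'(2) by (intro convexD) auto
  have "\<exists>w. w \<in> K \<and> w = (1 - s) *\<^sub>R T w + s *\<^sub>R f n" for n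
    using resolvent_exists[OF K'(1-3) T fK s(1,2)] by metis
  then obtain w where w: "\<And>n. w n \<in> K" "\<And>n. w n = (1 - s) *\<^sub>R T (w n) + s *\<^sub>R f n" by metis
  have TK: "T u \<in> K" if "u \<in> K" for u using K'(3) that by blast
  have w_far: "r \<le> norm (w n - p)" for n
  proof (rule far[OF w(1)])
    have "T (w n) - w n = s *\<^sub>R (T (w n) - f n)" by (subst (2) w(2)) (simp add: algebra_simps)
    then have "norm (T (w n) - w n) = s * norm (T (w n) - f n)" using s by simp
    also have "\<dots> \<le> s * d" using s by (intro mult_left_mono le_d TK w fK) auto
    finally show "norm (T (w n) - w n) \<le> e" using s(3) by simp
  qed
  have w_close: "norm (w n - w m) \<le> d / 2" for n m
  proof -
    have "w n - w m = (1 - s) *\<^sub>R (T (w n) - T (w m)) + (s / 2) *\<^sub>R (x n - x m)"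
      by (subst (1 2) w(2)) (simp add: f_def algebra_simps)
    then have "norm (w n - w m) \<le> norm ((1 - s) *\<^sub>R (T (w n) - T (w m))) + norm ((s / 2) *\<^sub>R (x n - x m))"
      by (metis norm_triangle_ineq)
    also have "\<dots> = (1 - s) * norm (T (w n) - T (w m)) + s / 2 * norm (x n - x m)" using s by simp
    also have "\<dots> \<le> (1 - s) * norm (w n - w m) + s / 2 * d"
      using s by (intro add_mono mult_left_mono Tle le_d w x) auto
    finally have "s * norm (w n - w m) \<le> s * (d / 2)" by (simp add: algebra_simps)
    then show ?thesis using s(1) by simp
  qed
  have w_near_x: "norm (w n - x n) \<le> d / 2 + inverse (Suc n) / s" for n
  proof -
    have "w n - x n = (1 - s) *\<^sub>R (T (w n) - T (x n)) + (1 - s) *\<^sub>R (T (x n) - x n) + (s / 2) *\<^sub>R (p - x n)"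
      by (subst (1) w(2)) (simp add: f_def algebra_simps flip: scaleR_add_left)
    then have "norm (w n - x n) \<le> norm ((1 - s) *\<^sub>R (T (w n) - T (x n)))
        + norm ((1 - s) *\<^sub>R (T (x n) - x n)) + norm ((s / 2) *\<^sub>R (p - x n))"
      by (metis norm_triangle_mono norm_triangle_ineq order_refl)
    also have "\<dots> = (1 - s) * norm (T (w n) - T (x n)) + (1 - s) * norm (T (x n) - x n) + s / 2 * norm (p - x n)"
      using s by simp
    also have "\<dots> \<le> (1 - s) * norm (w n - x n) + 1 * inverse (Suc n) + s / 2 * d"
      using s by (intro add_mono mult_left_mono mult_mono Tle le_d w x pK) auto
    finally have "s * norm (w n - x n) \<le> s * (d / 2 + inverse (Suc n) / s)"
      using s(1) by (simp add: algebra_simps)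
    then show ?thesis using s(1) by simp
  qed
  have bw: "bounded (range w)" using w(1) by (intro bounded_subset[OF bdd]) auto
  obtain q where q: "\<And>B e. B \<in> U \<Longrightarrow> e > 0 \<Longrightarrow>
      \<exists>(a, b)\<in>convex hull ((\<lambda>i. (x i, w i)) ` B). dist a p < e \<and> dist b q < e"
    and qw: "\<And>B. B \<in> U \<Longrightarrow> q \<in> closure (convex hull (w ` B))"
    using joint_weak_cluster_point[OF ns U(1) bw p] by blast
  define a where "a = q - p"
  have a_le: "norm a \<le> d / 2"
  proof (rule field_le_epsilon)
    fix \<epsilon> :: real assume "\<epsilon> > 0"
    define h where "h = \<epsilon> / 3"
    have h: "h > 0" "\<epsilon> = 3 * h" using \<open>\<epsilon> > 0\<close> by (auto simp: h_def)
    obtain N where N: "inverse (Suc N) < h * s" using reals_Archimedean[of "h * s"] h s by auto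
    define Z where "Z = (\<lambda>z :: 'a \<times> 'a. snd z - fst z) -` cball 0 (d / 2 + h)"
    have "(x n, w n) \<in> Z" if "n \<ge> N" for n
    proof -
      have "inverse (real (Suc n)) \<le> inverse (Suc N)" using that by (intro le_imp_inverse_le) auto
      then have "inverse (real (Suc n)) \<le> h * s" using N by linarith
      then have "inverse (real (Suc n)) / s \<le> h" by (simp only: pos_divide_le_eq[OF s(1)])
      then show ?thesis using w_near_x[of n] by (simp add: Z_def)
    qed
    moreover have "convex Z"
      unfolding Z_def
      by (intro convex_linear_vimage linear_compose_sub linear_fst linear_snd convex_cball)
    ultimately have "convex hull ((\<lambda>i. (x i, w i)) ` {N..}) \<subseteq> Z" by (intro hull_minimal) auto
    then obtain u v where uv: "(u, v) \<in> Z" "dist u p < h" "dist v q < h"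
      using q[OF U(2)[of N] h(1)] by blast
    have "norm (v - u) \<le> d / 2 + h" using uv(1) by (simp add: Z_def)
    moreover have "a = (v - u) + (u - p) - (v - q)" by (simp add: a_def)
    then have "norm a \<le> norm (v - u) + norm (u - p) + norm (v - q)"
      by (metis norm_triangle_ineq norm_triangle_ineq4 add_right_mono order_trans)
    ultimately show "norm a \<le> d / 2 + \<epsilon>" using uv(2,3) h(2) by (simp add: dist_norm)
  qed
  \<comment> \<open>The pairs for which \<open>a + b\<close> with \<open>b = w n - w m\<close> is the shorter diagonal; for the others it is \<open>a - b\<close>.\<close>
  define P where "P n = {m. norm (a + (w n - w m)) \<le> (1 - \<delta>) * d}" for n
  have notP: "norm (a - w n + w m) \<le> (1 - \<delta>) * d" if "m \<notin> P n" for n m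
  proof -
    have "norm (a + (w n - w m)) \<le> 2 * (1 - \<delta>) * (d / 2) \<or> norm (a - (w n - w m)) \<le> 2 * (1 - \<delta>) * (d / 2)"
      using ns a_le w_close unfolding nonsquare_by_def by blast
    then show ?thesis using that by (simp add: P_def algebra_simps)
  qed
  show False
  proof (cases "\<exists>n. P n \<in> U")
    case True
    \<comment> \<open>Averaging over \<open>m\<close> replaces \<open>w m\<close> by \<open>q\<close>, and \<open>a + w n - q = w n - p\<close>.\<close>
    then obtain n where n: "P n \<in> U" by blast
    have "closure (convex hull (w ` P n)) \<subseteq> cball (a + w n) ((1 - \<delta>) * d)"
      by (intro closure_minimal hull_minimal) (auto simp: P_def dist_norm algebra_simps)
    then have "norm (a + w n - q) \<le> (1 - \<delta>) * d" using qw[OF n] by (auto simp: dist_norm)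
    then have "norm (w n - p) \<le> (1 - \<delta>) * d" by (simp add: a_def algebra_simps)
    moreover have "\<delta> * d > 0" using \<delta> d by simp
    ultimately show False using w_far[of n] by (simp add: r_def algebra_simps)
  next
    case False
    \<comment> \<open>Averaging over \<open>n\<close> replaces \<open>w n\<close> by \<open>q\<close>, and \<open>a - q + w m = w m - p\<close>.\<close>
    define V where "V = {v. \<exists>A\<in>U. \<forall>m\<in>A. norm (a - v + w m) \<le> (1 - \<delta>) * d}"
    have "w n \<in> V" for n
      using U(3)[of "P n"] False notP unfolding V_def by blast
    then have "convex hull (w ` {0..}) \<subseteq> V"
      unfolding V_def by (intro hull_minimal convex_eventual_sublevel U(4)) auto
    moreover obtain v where v: "v \<in> convex hull (w ` {0..})" "dist v q < \<delta> * d / 2"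
      using qw[OF U(2)[of 0]] \<delta> d unfolding closure_approachable by (metis half_gt_zero mult_pos_pos)
    ultimately obtain A where A: "A \<in> U" "\<And>m. m \<in> A \<Longrightarrow> norm (a - v + w m) \<le> (1 - \<delta>) * d"
      unfolding V_def by blast
    obtain m where "m \<in> A" using A(1) U(1) unfolding filter_base_def by (metis ex_in_conv)
    have "w m - p = (a - v + w m) + (v - q)" by (simp add: a_def)
    then have "norm (w m - p) \<le> norm (a - v + w m) + norm (v - q)" by (metis norm_triangle_ineq)
    also have "\<dots> < (1 - \<delta>) * d + \<delta> * d / 2"
      using A(2)[OF \<open>m \<in> A\<close>] v(2) by (simp add: dist_norm)
    also have "\<dots> = r" by (simp add: r_def algebra_simps)
    finally show False using w_far[of m] by simp
  qed
qed

theorem corollary2p2: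
  assumes "uniformly_nonsquare TYPE('a::banach)"
  shows "fixed_point_property TYPE('a)"
  unfolding fixed_point_property_def
proof (intro allI impI)
  fix C :: "'a set" and T
  assume C: "C \<noteq> {}" "closed C" "bounded C" "convex C" and T: "T \<in> C \<rightarrow> C" "nonexpansive_on C T"
  obtain \<delta> where ns: "nonsquare_by \<delta> TYPE('a)" using uniformly_nonsquare_scaled[OF assms] .
  have "T ` C \<subseteq> C" using T(1) by auto
  then obtain K where K: "minimal_invariant T K" "K \<subseteq> C"
    using minimal_invariant_exists[OF ns C] by metis
  have bdd: "bounded K" using bounded_subset[OF C(3) K(2)] .
  have "nonexpansive_on K T" using T(2) K(2) unfolding nonexpansive_on_def by blast
  then have 0: "diameter K = 0" using minimal_invariant_diameter_0[OF ns K(1) _ bdd] by blast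
  obtain x where x: "x \<in> K" "T x \<in> K" using K(1) unfolding minimal_invariant_def by blast
  then have "dist (T x) x \<le> 0" using diameter_bounded_bound[OF bdd, of "T x" x] 0 by simp
  then show "\<exists>x\<in>C. T x = x" using x(1) K(2) by auto
qed

end
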